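(* Let $q$ be such that $1/q$ is a prime power and set $\Bbbk:=\mathbb{F}_{1/q}$. Let $\lambda$ be a partition of $n$ and let $N\in\mathfrak{gl}_n(\Bbbk)$ be nilpotent with $\mathrm{JF}(N)=\lambda$. Let $\alpha=(\alpha_1,\dots,\alpha_k)$ be a weak composition of $n$. (i) For every semistandard tableau $T$ of shape $\lambda$ and content $\alpha$, $$\mathrm{wt}_q(T)=q^{n(\lambda)-n(\alpha)}\,\big|\{F\in\mathrm{Fl}_\alpha : F \text{ is strictly compatible with } N \text{ and } \mathrm{JF}(N;F)=T\}\big|.$$ (ii) Consequently, the coefficient of $x_1^{\alpha_1}\cdots x_k^{\alpha_k}$ in $W_\lambda(\mathbf{x};q)$ equals $q^{n(\lambda)-n(\alpha)}\,|\{F\in\mathrm{Fl}_\alpha : F\text{ is strictly compatible with }N\}|$.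
   Context: A weak composition of $n$ is a finite sequence $\alpha=(\alpha_1,\dots,\alpha_k)$ of nonnegative integers summing to $n$; for it, $n(\alpha):=\sum_i\binom{\alpha_i}{2}$ (the same formula defines $n(\lambda)$ for a partition $\lambda$). For a nilpotent endomorphism $N$ of a finite-dimensional vector space, $\mathrm{JF}(N)$ denotes the partition $\lambda$ with $\lambda_1+\cdots+\lambda_i=\dim\ker(N^i)$ for all $i\ge0$ (equivalently the conjugate of the partition of Jordan block sizes). $\mathrm{Fl}_\alpha$ is the set of chains $F=(0=F_0\subseteq F_1\subseteq\cdots\subseteq F_k=\Bbbk^n)$ of subspaces with $\dim F_i=\alpha_1+\cdots+\alpha_i$. $F$ and $N\in\mathfrak{gl}_n$ are strictly compatible if $N(F_i)\subseteq F_{i-1}$ for $1\le i\le k$; then $\mathrm{JF}(N;F)$ is the semistandard tableau $T$ of shape $\mathrm{JF}(N)$ and content $\alpha$ such that the boxes containing entries $\le i$ form the shape $T^{(i)}=\mathrm{JF}(N|_{F_i})$ for each $i$ (this is well-defined). For a semistandard tableau $T$, $T^{(j)}$ is the partition formed by the boxes with entries $\le j$ ($T^{(0)}=\varnothing$), with parts $T^{(j)}_i$. Define $[m]_q=1+q+\cdots+q^{m-1}$, $[m]_q!=[m]_q[m-1]_q\cdots[1]_q$, $\binom{m}{r}_q=\frac{[m]_q!}{[r]_q![m-r]_q!}$. The $q$-weight is $\mathrm{wt}_q(T)=\prod_{i,j\ge1}\binom{T^{(j)}_i-T^{(j)}_{i+1}}{T^{(j)}_i-T^{(j-1)}_i}_q$,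 and the $q$-Whittaker function is $W_\lambda(\mathbf{x};q)=\sum_{T}\mathrm{wt}_q(T)\prod_i x_i^{\#\{i\text{'s in }T\}}$, summed over semistandard tableaux $T$ of shape $\lambda$ with entries in $\mathbb{Z}_{>0}$. *)

theory Defs
  imports "HOL-Analysis.Analysis" "HOL-Library.Groups_Big_Fun"
begin

text \<open>Vectors in k^n are elements of type 'k^'n (n = CARD('n)); matrices are 'k^'n^'n,
  acting on vectors by (*v). Dimension of subspaces is vec.dim.\<close>

definition nilpotent_mat :: "'k::field^'n^'n \<Rightarrow> bool" where
  "nilpotent_mat N \<longleftrightarrow> (\<exists>m. ((*v) N ^^ m) = (\<lambda>x. 0))"

definition ker_pow :: "'k::field^'n^'n \<Rightarrow> nat \<Rightarrow> ('k^'n) set" where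
  "ker_pow N m = {x. ((*v) N ^^ m) x = 0}"

text \<open>Partitions are functions nat => nat indexed from 1 (value 0 at index 0).\<close>
definition is_partition_of :: "(nat \<Rightarrow> nat) \<Rightarrow> nat \<Rightarrow> bool" where
  "is_partition_of lam n \<longleftrightarrow> lam 0 = 0 \<and> (\<forall>i\<ge>1. lam (i+1) \<le> lam i)
     \<and> finite {i. lam i \<noteq> 0} \<and> (\<Sum>i\<in>{i. lam i \<noteq> 0}. lam i) = n"

text \<open>JF(N|_V): parts lambda_1+...+lambda_i = dim ker((N|_V)^i) = dim (V \<inter> ker N^i).\<close>
definition JF_on :: "('k::field^'n) set \<Rightarrow> 'k^'n^'n \<Rightarrow> nat \<Rightarrow> nat" where
  "JF_on V N i = (if i = 0 then 0
     else vec.dim (V \<inter> ker_pow N i) - vec.dim (V \<inter> ker_pow N (i - 1)))"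

definition JF :: "'k::field^'n^'n \<Rightarrow> nat \<Rightarrow> nat" where
  "JF N = JF_on UNIV N"

text \<open>n(lambda) and n(alpha).\<close>
definition n_part :: "(nat \<Rightarrow> nat) \<Rightarrow> nat" where
  "n_part lam = (\<Sum>i\<in>{i. lam i \<noteq> 0}. lam i choose 2)"

definition n_comp :: "nat list \<Rightarrow> nat" where
  "n_comp alpha = sum_list (map (\<lambda>a. a choose 2) alpha)"

text \<open>Tableaux: T i j is the entry in row i, column j (both 1-indexed); 0 outside the shape.\<close>
definition in_shape :: "(nat \<Rightarrow> nat) \<Rightarrow> nat \<Rightarrow> nat \<Rightarrow> bool" where
  "in_shape lam i j \<longleftrightarrow> 1 \<le> i \<and> 1 \<le> j \<and> j \<le> lam i"

definition ssyt :: "(nat \<Rightarrow> nat) \<Rightarrow> (nat \<Rightarrow> nat \<Rightarrow> nat) \<Rightarrow> bool" where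
  "ssyt lam T \<longleftrightarrow> (\<forall>i j. in_shape lam i j \<longleftrightarrow> T i j \<noteq> 0)
     \<and> (\<forall>i j. in_shape lam i (j+1) \<longrightarrow> T i j \<le> T i (j+1))
     \<and> (\<forall>i j. in_shape lam (i+1) j \<longrightarrow> T i j < T (i+1) j)"

text \<open>Content alpha = (alpha_1,...,alpha_k): exactly alpha_m entries equal to m for m \<le> k,
  and no entries larger than k.\<close>
definition has_content :: "(nat \<Rightarrow> nat \<Rightarrow> nat) \<Rightarrow> nat list \<Rightarrow> bool" where
  "has_content T alpha \<longleftrightarrow> (\<forall>m\<ge>1. card {(i,j). 1 \<le> i \<and> 1 \<le> j \<and> T i j = m}
       = (if m \<le> length alpha then alpha ! (m - 1) else 0))"

definition ssyt_content :: "(nat \<Rightarrow> nat) \<Rightarrow> nat list \<Rightarrow> (nat \<Rightarrow> nat \<Rightarrow> nat) \<Rightarrow> bool" where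
  "ssyt_content lam alpha T \<longleftrightarrow> ssyt lam T \<and> has_content T alpha"

text \<open>T^(j)_i: number of boxes in row i with entry \<le> j.\<close>
definition subshape :: "(nat \<Rightarrow> nat \<Rightarrow> nat) \<Rightarrow> nat \<Rightarrow> nat \<Rightarrow> nat" where
  "subshape T j i = card {c. 1 \<le> c \<and> 0 < T i c \<and> T i c \<le> j}"

text \<open>q-numbers.\<close>
definition qint :: "real \<Rightarrow> nat \<Rightarrow> real" where
  "qint q m = (\<Sum>i<m. q ^ i)"

definition qfact :: "real \<Rightarrow> nat \<Rightarrow> real" where
  "qfact q m = (\<Prod>i\<in>{1..m}. qint q i)"

definition qbinom :: "real \<Rightarrow> nat \<Rightarrow> nat \<Rightarrow> real" where
  "qbinom q m r = (if r \<le> m then qfact q m / (qfact q r * qfact q (m - r)) else 0)"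

text \<open>wt_q(T): product over all i, j \<ge> 1 (finitely many factors differ from 1).\<close>
definition wt_q :: "real \<Rightarrow> (nat \<Rightarrow> nat \<Rightarrow> nat) \<Rightarrow> real" where
  "wt_q q T = Prod_any (\<lambda>(i,j). if 1 \<le> i \<and> 1 \<le> j then
       qbinom q (subshape T j i - subshape T j (i+1)) (subshape T j i - subshape T (j-1) i)
     else 1)"

text \<open>Partial flags Fl_alpha: lists F_0 ... F_k of subspaces.\<close>
definition Fl :: "nat list \<Rightarrow> (('k::field^'n) set) list set" where
  "Fl alpha = {F. length F = length alpha + 1
     \<and> (\<forall>i\<le>length alpha. vec.subspace (F ! i) \<and> vec.dim (F ! i) = sum_list (take i alpha))
     \<and> (\<forall>i<length alpha. F ! i \<subseteq> F ! (i+1))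
     \<and> F ! 0 = {0} \<and> F ! length alpha = UNIV}"

definition strictly_compatible :: "'k::field^'n^'n \<Rightarrow> ('k^'n) set list \<Rightarrow> bool" where
  "strictly_compatible N F \<longleftrightarrow> (\<forall>i. 1 \<le> i \<and> i < length F \<longrightarrow> (*v) N ` (F ! i) \<subseteq> F ! (i - 1))"

text \<open>JF(N;F) = T: for every i, the boxes of T with entries \<le> i form JF(N|_{F_i}).\<close>
definition JF_flag_is :: "'k::field^'n^'n \<Rightarrow> ('k^'n) set list \<Rightarrow> (nat \<Rightarrow> nat \<Rightarrow> nat) \<Rightarrow> bool" where
  "JF_flag_is N F T \<longleftrightarrow> (\<forall>i<length F. subshape T i = JF_on (F ! i) N)"

end

theory Submission
  imports Defs
begin

text \<open>
  Induction on the length of \<alpha>, removing the top space U of the flag. If F is strictly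
  compatible with N, its penultimate space W satisfies N U \<subseteq> W \<subseteq> U, and the type
  \<mu> = JF(N|W) is the shape of T with its largest entries removed; in particular \<mu>
  interlaces \<lambda>. For such W, the dimensions of W \<inter> ker N^i determine those of
  W \<inter> A_i, where A_i = (U \<inter> ker N^i) + N U, so the W of type \<mu> are the subspaces
  meeting a fixed filtration of U in prescribed dimensions. Counting them one layer at a
  time over the field with Q elements (by double counting of independent tuples) gives Q^E
  times the product of the 1/Q-binomials [\<lambda>_i - \<lambda>_(i+1), \<lambda>_i - \<mu>_i]. That product
  is exactly the factor by which wt_q changes when the largest entries are removed from T,
  and E is the change of n(\<lambda>) - n(\<alpha>). Part (ii) follows by summing (i) over all
  tableaux, as every compatible flag F has exactly one tableau JF(N; F).
\<close>

lemma card_span_insert: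
  fixes B :: "('k::{field,finite}^'n) set"
  assumes "b \<notin> vec.span B"
  shows "card (vec.span (insert b B)) = CARD('k) * card (vec.span B)"
proof -
  let ?f = "\<lambda>(s, c::'k). s + c *s b"
  have inj: "inj_on ?f (vec.span B \<times> UNIV)"
  proof (rule inj_onI, clarsimp)
    fix s c s' c' assume s: "s \<in> vec.span B" "s' \<in> vec.span B"
      and e: "s + c *s b = s' + c' *s b"
    show "s = s' \<and> c = c'"
    proof (cases "c = c'")
      case True then show ?thesis using e by simp
    next
      case False
      have "(c - c') *s b = s' - s" using e by (simp add: algebra_simps vec.scale_left_diff_distrib)
      moreover have "inverse (c - c') *s ((c - c') *s b) = b" using False
        by (metis vec.scale_scale left_inverse right_minus_eq vec.scale_one)
      ultimately have "b = inverse (c - c') *s (s' - s)" by simp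
      moreover have "inverse (c - c') *s (s' - s) \<in> vec.span B"
        using s by (intro vec.span_scale vec.span_diff) auto
      ultimately show ?thesis using assms by simp
    qed
  qed
  have img: "?f ` (vec.span B \<times> UNIV) = vec.span (insert b B)"
  proof (rule set_eqI)
    fix x show "x \<in> ?f ` (vec.span B \<times> UNIV)
        \<longleftrightarrow> x \<in> vec.span (insert b B)"
      unfolding vec.span_insert
    proof
      assume "x \<in> ?f ` (vec.span B \<times> UNIV)"
      then obtain s c where "s \<in> vec.span B" "x = s + c *s b" by auto
      then show "x \<in> {x. \<exists>k. x - k *s b \<in> vec.span B}"
        by (intro CollectI exI[of _ c]) simp
    next
      assume "x \<in> {x. \<exists>k. x - k *s b \<in> vec.span B}"
      then obtain k where "x - k *s b \<in> vec.span B" by auto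
      then show "x \<in> ?f ` (vec.span B \<times> UNIV)"
        by (intro image_eqI[of _ _ "(x - k *s b, k)"]) auto
    qed
  qed
  have "card (vec.span (insert b B)) = card (vec.span B \<times> (UNIV::'k set))"
    using card_image[OF inj] img by simp
  also have "\<dots> = CARD('k) * card (vec.span B)" by (simp add: card_cartesian_product)
  finally show ?thesis .
qed

lemma card_span_independent:
  fixes B :: "('k::{field,finite}^'n) set"
  assumes "vec.independent B"
  shows "card (vec.span B) = CARD('k) ^ card B"
proof -
  have "finite B" using assms vec.finiteI_independent by auto
  then show ?thesis using assms
  proof (induction B rule: finite_induct)
    case empty then show ?case by simp
  next
    case (insert b B)
    have "vec.independent B" using insert.prems vec.independent_mono by blast
    moreover have "b \<notin> vec.span B"
      using insert.prems insert.hyps(2) by (metis vec.independent_insert)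
    ultimately show ?case using insert card_span_insert[of b B] by simp
  qed
qed

lemma card_subspace:
  fixes S :: "('k::{field,finite}^'n) set"
  assumes "vec.subspace S"
  shows "card S = CARD('k) ^ vec.dim S"
proof -
  obtain B where B: "B \<subseteq> S" "vec.independent B" "S \<subseteq> vec.span B"
    "card B = vec.dim S"
    using vec.basis_exists by blast
  have "vec.span B = S" using B assms vec.span_minimal by blast
  then show ?thesis using card_span_independent[OF B(2)] B(4) by simp
qed

lemma two_le_card_field: "2 \<le> CARD('k::{field,finite})"
proof -
  have "card {0::'k, 1} \<le> CARD('k)" by (rule card_mono) auto
  then show ?thesis by simp
qed

lemma card_field_power_inject:
  assumes "CARD('k::{field,finite}) ^ a = CARD('k) ^ b" shows "a = b"
  using assms two_le_card_field[where 'k='k] by (simp add: power_inject_exp)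

lemma card_eq_sum_card_fibers:
  assumes "finite B" "g ` A \<subseteq> B" "finite A"
  shows "card A = (\<Sum>y\<in>B. card {x\<in>A. g x = y})"
proof -
  have "A = (\<Union>y\<in>B. {x\<in>A. g x = y})" using assms(2) by auto
  moreover have "card (\<Union>y\<in>B. {x\<in>A. g x = y})
      = (\<Sum>y\<in>B. card {x\<in>A. g x = y})"
    by (rule card_UN_disjoint) (use assms(1,3) in auto)
  ultimately show ?thesis by simp
qed

lemma card_eq_by_constant_fibers:
  assumes "finite A" "finite B" "g ` A \<subseteq> B"
    "\<And>y. y \<in> B \<Longrightarrow> card {x\<in>A. g x = y} = c"
  shows "card A = card B * c"
  using card_eq_sum_card_fibers[OF assms(2,3,1)] assms(4) by simp

lemma real_card_eq_by_constant_fibers: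
  assumes "finite A" "finite B" "g ` A \<subseteq> B"
    "\<And>y. y \<in> B \<Longrightarrow> real (card {x\<in>A. g x = y}) = c"
  shows "real (card A) = real (card B) * c"
  using card_eq_sum_card_fibers[OF assms(2,3,1)] assms(4) by simp

lemma subspace_mat_image:
  "vec.subspace S \<Longrightarrow> vec.subspace ((*v) (N::'k::field^'n^'n) ` S)"
  by (rule vec.subspace_image)

lemma linear_mat_funpow: "Vector_Spaces.linear (*s) (*s) ((*v) (N::'k::field^'n^'n) ^^ i)"
proof (induction i)
  case 0 then show ?case by (simp add: vec.linear_id[unfolded id_def])
next
  case (Suc i)
  then show ?case
    using Vector_Spaces.linear_compose[OF Suc.IH matrix_vector_mul_linear_gen[of N]]
    by (simp add: o_def)
qed

lemma subspace_ker_pow: "vec.subspace (ker_pow (N::'k::field^'n^'n) i)"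
  unfolding ker_pow_def using vec.linear_subspace_kernel[OF linear_mat_funpow] .

lemma mem_ker_pow_Suc_0 [simp]: "x \<in> ker_pow N (Suc 0) \<longleftrightarrow> N *v x = 0"
  by (simp add: ker_pow_def)

lemma card_eq_card_image_mult_card_kernel:
  fixes N :: "'k::{field,finite}^'n^'n"
  assumes S: "vec.subspace S"
  shows "card S = card ((*v) N ` S) * card (S \<inter> ker_pow N 1)"
proof (rule card_eq_by_constant_fibers[where g="(*v) N"])
  fix y assume "y \<in> (*v) N ` S"
  then obtain s0 where s0: "s0 \<in> S" "y = N *v s0" by auto
  have "{x \<in> S. N *v x = y} = (\<lambda>z. s0 + z) ` (S \<inter> ker_pow N 1)"
  proof (rule set_eqI, rule iffI)
    fix x assume x: "x \<in> {x \<in> S. N *v x = y}"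
    have "x - s0 \<in> S" using x s0 S vec.subspace_diff by auto
    moreover have "N *v (x - s0) = 0" using x s0 by (simp add: matrix_vector_mult_diff_distrib)
    ultimately show "x \<in> (\<lambda>z. s0 + z) ` (S \<inter> ker_pow N 1)"
      by (intro image_eqI[of _ _ "x - s0"]) auto
  next
    fix x assume "x \<in> (\<lambda>z. s0 + z) ` (S \<inter> ker_pow N 1)"
    then obtain z where z: "z \<in> S" "N *v z = 0" "x = s0 + z" by auto
    then show "x \<in> {x \<in> S. N *v x = y}" using s0 S vec.subspace_add
      by (auto simp: matrix_vector_right_distrib)
  qed
  then show "card {x \<in> S. N *v x = y} = card (S \<inter> ker_pow N 1)"
    by (simp add: card_image)
qed auto

text \<open>Rank-nullity on a subspace; over a finite field it is a consequence of counting.\<close>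

lemma dim_image_plus_dim_kernel:
  fixes N :: "'k::{field,finite}^'n^'n"
  assumes S: "vec.subspace S"
  shows "vec.dim ((*v) N ` S) + vec.dim (S \<inter> ker_pow N 1) = vec.dim S"
proof -
  have s1: "vec.subspace ((*v) N ` S)" using S by (rule subspace_mat_image)
  have s2: "vec.subspace (S \<inter> ker_pow N 1)" using S subspace_ker_pow vec.subspace_inter
    by blast
  have "CARD('k) ^ vec.dim S = CARD('k) ^ (vec.dim ((*v) N ` S) + vec.dim (S \<inter> ker_pow N 1))"
    using card_eq_card_image_mult_card_kernel[OF S, of N]
      card_subspace[OF S] card_subspace[OF s1] card_subspace[OF s2]
    by (simp add: power_add)
  then show ?thesis using card_field_power_inject by metis
qed

definition independent_mod :: "('k::field^'n) set \<Rightarrow> ('k^'n) list \<Rightarrow> bool" where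
  "independent_mod B vs
      \<longleftrightarrow> (\<forall>j<length vs. vs ! j \<notin> vec.span (B \<union> set (take j vs)))"

definition independent_tuples :: "('k::field^'n) set \<Rightarrow> ('k^'n) set \<Rightarrow> nat \<Rightarrow> ('k^'n) list set" where
  "independent_tuples A B d
      = {vs. length vs = d \<and> set vs \<subseteq> A \<and> independent_mod B vs}"

definition tuple_count :: "nat \<Rightarrow> nat \<Rightarrow> nat \<Rightarrow> nat \<Rightarrow> nat" where
  "tuple_count Q a b d = (\<Prod>j<d. Q ^ a - Q ^ (b + j))"

lemma independent_mod_Nil [simp]: "independent_mod B []"
  by (simp add: independent_mod_def)

lemma independent_mod_snoc:
  "independent_mod B (vs @ [v]) \<longleftrightarrow>
    independent_mod B vs \<and> v \<notin> vec.span (B \<union> set vs)"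
  unfolding independent_mod_def by (auto simp: nth_append less_Suc_eq)

lemma independent_mod_mono:
  assumes "independent_mod B vs" "Y \<subseteq> B" shows "independent_mod Y vs"
  using assms unfolding independent_mod_def by (meson Un_mono order_refl subsetD vec.span_mono)

lemma dim_span_independent_mod:
  assumes "vec.subspace B" "independent_mod B vs"
  shows "vec.dim (vec.span (B \<union> set vs)) = vec.dim B + length vs"
  using assms(2)
proof (induction vs rule: rev_induct)
  case Nil then show ?case using assms(1) by simp
next
  case (snoc v vs)
  then have i: "independent_mod B vs" "v \<notin> vec.span (B \<union> set vs)"
    by (auto simp: independent_mod_snoc)
  have "B \<union> set (vs @ [v]) = insert v (B \<union> set vs)" by auto
  then show ?case using snoc.IH[OF i(1)] i(2) by (simp add: vec.dim_insert)
qed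

lemma finite_independent_tuples [simp]:
  "finite (independent_tuples (A::('k::{field,finite}^'n) set) B d)"
proof -
  have "independent_tuples A B d \<subseteq> {xs. set xs \<subseteq> UNIV \<and> length xs = d}"
    by (auto simp: independent_tuples_def)
  then show ?thesis using finite_lists_length_eq[of "UNIV::('k^'n) set" d] finite_subset by auto
qed

lemma independent_tuples_Suc_fiber:
  assumes ws: "ws \<in> independent_tuples A B d"
  shows "{vs \<in> independent_tuples A B (Suc d). butlast vs = ws} =
    (\<lambda>v. ws @ [v]) ` (A - vec.span (B \<union> set ws))"
proof (rule set_eqI, rule iffI)
  fix vs assume vs: "vs \<in> {vs \<in> independent_tuples A B (Suc d). butlast vs = ws}"
  then have "vs \<noteq> []" by (auto simp: independent_tuples_def)
  then have e: "vs = ws @ [last vs]" using vs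
    by (metis (mono_tags) append_butlast_last_id mem_Collect_eq)
  have p: "set vs \<subseteq> A" "independent_mod B vs" using vs
    by (auto simp: independent_tuples_def)
  then have "last vs \<notin> vec.span (B \<union> set ws)" using e by (metis independent_mod_snoc)
  moreover have "last vs \<in> A" using p(1) \<open>vs \<noteq> []\<close> by auto
  ultimately show "vs \<in> (\<lambda>v. ws @ [v]) ` (A - vec.span (B \<union> set ws))" using e
    by blast
next
  fix vs assume "vs \<in> (\<lambda>v. ws @ [v]) ` (A - vec.span (B \<union> set ws))"
  then show "vs \<in> {vs \<in> independent_tuples A B (Suc d). butlast vs = ws}"
    using ws by (auto simp: independent_tuples_def independent_mod_snoc)
qed

lemma card_independent_tuples:
  fixes A B :: "('k::{field,finite}^'n) set"
  assumes A: "vec.subspace A" and B: "vec.subspace B" and BA: "B \<subseteq> A"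
  shows "card (independent_tuples A B d) = tuple_count CARD('k) (vec.dim A) (vec.dim B) d"
proof (induction d)
  case 0
  have "independent_tuples A B 0 = {[]}" by (auto simp: independent_tuples_def)
  then show ?case by (simp add: tuple_count_def)
next
  case (Suc d)
  have "card (independent_tuples A B (Suc d)) =
      card (independent_tuples A B d) * (CARD('k) ^ vec.dim A - CARD('k) ^ (vec.dim B + d))"
  proof (rule card_eq_by_constant_fibers[where g=butlast])
    show "butlast ` independent_tuples A B (Suc d) \<subseteq> independent_tuples A B d"
    proof
      fix ws assume "ws \<in> butlast ` independent_tuples A B (Suc d)"
      then obtain vs where vs: "vs \<in> independent_tuples A B (Suc d)" "ws = butlast vs" by auto
      then have "vs \<noteq> []" by (auto simp: independent_tuples_def)
      then have "vs = butlast vs @ [last vs]" by simp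
      then show "ws \<in> independent_tuples A B d" using vs
        by (auto simp: independent_tuples_def independent_mod_snoc dest: in_set_butlastD)
          (metis independent_mod_snoc)
    qed
  next
    fix ws assume ws: "ws \<in> independent_tuples A B d"
    let ?S = "vec.span (B \<union> set ws)"
    have "?S \<subseteq> A" using ws A BA
      by (intro vec.span_minimal) (auto simp: independent_tuples_def)
    then have "card (A - ?S) = card A - card ?S" by (simp add: card_Diff_subset finite_subset)
    moreover have "card ?S = CARD('k) ^ (vec.dim B + d)"
      using card_subspace[of ?S] dim_span_independent_mod[OF B] ws
        by (simp add: independent_tuples_def)
    moreover have "card ((\<lambda>v. ws @ [v]) ` (A - ?S)) = card (A - ?S)"
      by (rule card_image) (auto simp: inj_on_def)
    ultimately show "card {vs \<in> independent_tuples A B (Suc d). butlast vs = ws} =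
        CARD('k) ^ vec.dim A - CARD('k) ^ (vec.dim B + d)"
      using card_subspace[OF A] independent_tuples_Suc_fiber[OF ws] by simp
  qed auto
  then show ?case using Suc by (simp add: tuple_count_def)
qed

definition meeting_subspaces ::
  "('k::field^'n) set \<Rightarrow> ('k^'n) set \<Rightarrow> ('k^'n) set \<Rightarrow> nat \<Rightarrow> ('k^'n) set set" where
  "meeting_subspaces A B Y d =
    {X. vec.subspace X \<and> Y \<subseteq> X \<and> X \<subseteq> A \<and> X \<inter> B = Y \<and> vec.dim X = vec.dim Y + d}"

lemma span_independent_tuple_mem_meeting_subspaces:
  fixes A B Y :: "('k::{field,finite}^'n) set"
  assumes A: "vec.subspace A" and B: "vec.subspace B" and Y: "vec.subspace Y"
    and YB: "Y \<subseteq> B" and BA: "B \<subseteq> A" and vs: "vs \<in> independent_tuples A B d"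
  shows "vec.span (Y \<union> set vs) \<in> meeting_subspaces A B Y d"
proof -
  define X where "X = vec.span (Y \<union> set vs)"
  have vs: "length vs = d" "set vs \<subseteq> A" "independent_mod B vs"
    using vs by (auto simp: independent_tuples_def)
  have sX: "vec.subspace X" and YX: "Y \<subseteq> X"
    unfolding X_def using vec.span_superset[of "Y \<union> set vs"] by auto
  have XA: "X \<subseteq> A" unfolding X_def using vs(2) YB BA A by (intro vec.span_minimal) auto
  have dX: "vec.dim X = vec.dim Y + d"
    using dim_span_independent_mod[OF Y independent_mod_mono[OF vs(3) YB]] vs(1)
      by (simp add: X_def)
  let ?XB = "{x + y |x y. x \<in> X \<and> y \<in> B}"
  have "vec.span (B \<union> set vs) \<subseteq> ?XB"
  proof (rule vec.span_minimal)
    show "vec.subspace ?XB" using sX B by (rule vec.subspace_sums)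
    have "set vs \<subseteq> X" unfolding X_def using vec.span_superset[of "Y \<union> set vs"]
      by blast
    show "B \<union> set vs \<subseteq> ?XB"
    proof
      fix z assume "z \<in> B \<union> set vs"
      then show "z \<in> ?XB"
      proof
        assume "z \<in> B" then show ?thesis using vec.subspace_0[OF sX] by force
      next
        assume "z \<in> set vs" then show ?thesis
          using \<open>set vs \<subseteq> X\<close> vec.subspace_0[OF B] by force
      qed
    qed
  qed
  then have "vec.dim (vec.span (B \<union> set vs)) \<le> vec.dim ?XB" by (rule vec.dim_subset)
  then have "vec.dim B + d \<le> vec.dim ?XB" using dim_span_independent_mod[OF B vs(3)] vs(1)
    by simp
  moreover have "vec.dim ?XB + vec.dim (X \<inter> B) = vec.dim X + vec.dim B"
    using vec.dim_sums_Int[OF sX B] .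
  ultimately have "vec.dim (X \<inter> B) \<le> vec.dim Y" using dX by linarith
  then have "Y = X \<inter> B"
    using YX YB Y sX B by (intro vec.subspace_dim_equal) (auto intro: vec.subspace_inter)
  then have "X \<in> meeting_subspaces A B Y d" using sX YX XA dX
    by (auto simp: meeting_subspaces_def)
  then show ?thesis by (simp add: X_def)
qed

lemma independent_mod_if_Int_eq:
  assumes B: "vec.subspace B" and X: "vec.subspace X" and XB: "X \<inter> B = Y"
    and vs: "set vs \<subseteq> X" "independent_mod Y vs"
  shows "independent_mod B vs"
  unfolding independent_mod_def
proof (intro allI impI notI)
  fix j assume j: "j < length vs" and "vs ! j \<in> vec.span (B \<union> set (take j vs))"
  then obtain u w where uw: "u \<in> vec.span B" "w \<in> vec.span (set (take j vs))"
    "vs ! j = u + w"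
    unfolding vec.span_Un by auto
  have "set (take j vs) \<subseteq> X" using vs(1) by (meson order_trans set_take_subset)
  then have wX: "w \<in> X" using uw(2) vec.span_minimal[OF _ X] by auto
  have "vs ! j \<in> X" using vs(1) j by auto
  moreover have "u = vs ! j - w" using uw(3) by simp
  ultimately have "u \<in> X" using vec.subspace_diff[OF X _ wX] by simp
  moreover have "u \<in> B" using uw(1) B by (metis vec.span_eq_iff)
  ultimately have "u \<in> Y" using XB by blast
  then have "u \<in> vec.span (Y \<union> set (take j vs))"
    using vec.span_superset[of "Y \<union> set (take j vs)"] by blast
  moreover have "w \<in> vec.span (Y \<union> set (take j vs))"
    using uw(2) vec.span_mono[of "set (take j vs)" "Y \<union> set (take j vs)"] by blast
  ultimately have "vs ! j \<in> vec.span (Y \<union> set (take j vs))"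
    unfolding uw(3) by (rule vec.span_add)
  then show False using vs(2) j by (simp add: independent_mod_def)
qed

lemma independent_tuples_spanning:
  fixes A B Y :: "('k::{field,finite}^'n) set"
  assumes B: "vec.subspace B" and Y: "vec.subspace Y" and YB: "Y \<subseteq> B"
    and X: "X \<in> meeting_subspaces A B Y d"
  shows "{vs \<in> independent_tuples A B d. vec.span (Y \<union> set vs) = X}
      = independent_tuples X Y d"
proof -
  have sX: "vec.subspace X" and YX: "Y \<subseteq> X" and XA: "X \<subseteq> A"
    and XB: "X \<inter> B = Y"
    and dX: "vec.dim X = vec.dim Y + d" using X by (auto simp: meeting_subspaces_def)
  show ?thesis
  proof (rule set_eqI, rule iffI)
    fix vs assume "vs \<in> {vs \<in> independent_tuples A B d. vec.span (Y \<union> set vs) = X}"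
    then have vs: "length vs = d" "independent_mod B vs" "vec.span (Y \<union> set vs) = X"
      by (auto simp: independent_tuples_def)
    have "set vs \<subseteq> X" using vec.span_superset[of "Y \<union> set vs"] vs(3) by blast
    then show "vs \<in> independent_tuples X Y d"
      using vs independent_mod_mono[OF vs(2) YB] by (simp add: independent_tuples_def)
  next
    fix vs assume "vs \<in> independent_tuples X Y d"
    then have vs: "length vs = d" "set vs \<subseteq> X" "independent_mod Y vs"
      by (auto simp: independent_tuples_def)
    have "vec.span (Y \<union> set vs) = X"
    proof (rule vec.subspace_dim_equal)
      show "vec.span (Y \<union> set vs) \<subseteq> X" using vs(2) YX sX
        by (intro vec.span_minimal) auto
      show "vec.dim X \<le> vec.dim (vec.span (Y \<union> set vs))"
        using dim_span_independent_mod[OF Y vs(3)] dX vs(1) by simp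
    qed (simp_all add: sX)
    then show "vs \<in> {vs \<in> independent_tuples A B d. vec.span (Y \<union> set vs) = X}"
      using vs XA independent_mod_if_Int_eq[OF B sX XB vs(2,3)]
        by (auto simp: independent_tuples_def)
  qed
qed

text \<open>Double counting of the tuples independent modulo B in A, grouped by their span with Y.\<close>

lemma tuple_count_eq_card_meeting_subspaces_mult:
  fixes A B Y :: "('k::{field,finite}^'n) set"
  assumes A: "vec.subspace A" and B: "vec.subspace B" and Y: "vec.subspace Y"
    and YB: "Y \<subseteq> B" and BA: "B \<subseteq> A"
  shows "tuple_count CARD('k) (vec.dim A) (vec.dim B) d =
         card (meeting_subspaces A B Y d) * tuple_count CARD('k) (vec.dim Y + d) (vec.dim Y) d"
proof -
  have "card (independent_tuples A B d) =
      card (meeting_subspaces A B Y d) * tuple_count CARD('k) (vec.dim Y + d) (vec.dim Y) d"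
  proof (rule card_eq_by_constant_fibers[where g="\<lambda>vs. vec.span (Y \<union> set vs)"])
    show "(\<lambda>vs. vec.span (Y \<union> set vs)) ` independent_tuples A B d
        \<subseteq> meeting_subspaces A B Y d"
      using span_independent_tuple_mem_meeting_subspaces[OF assms] by blast
  next
    fix X assume X: "X \<in> meeting_subspaces A B Y d"
    then have "vec.subspace X" "Y \<subseteq> X" "vec.dim X = vec.dim Y + d"
      by (auto simp: meeting_subspaces_def)
    then show "card {vs \<in> independent_tuples A B d. vec.span (Y \<union> set vs) = X} =
        tuple_count CARD('k) (vec.dim Y + d) (vec.dim Y) d"
      using independent_tuples_spanning[OF B Y YB X] card_independent_tuples[OF _ Y] by simp
  qed simp_all
  then show ?thesis using card_independent_tuples[OF A B BA] by simp
qed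

definition meeting_count :: "nat \<Rightarrow> nat \<Rightarrow> nat \<Rightarrow> nat \<Rightarrow> nat \<Rightarrow> real" where
  "meeting_count Q a b y d = real (tuple_count Q a b d) / real (tuple_count Q (y + d) y d)"

lemma tuple_count_pos: "2 \<le> Q \<Longrightarrow> 0 < tuple_count Q (y + d) y d"
  unfolding tuple_count_def by (intro prod_pos) (auto intro!: power_strict_increasing)

lemma card_meeting_subspaces:
  fixes A B Y :: "('k::{field,finite}^'n) set"
  assumes "vec.subspace A" "vec.subspace B" "vec.subspace Y" "Y \<subseteq> B" "B \<subseteq> A"
  shows "real (card (meeting_subspaces A B Y d)) =
    meeting_count CARD('k) (vec.dim A) (vec.dim B) (vec.dim Y) d"
proof -
  have "0 < tuple_count CARD('k) (vec.dim Y + d) (vec.dim Y) d"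
    using tuple_count_pos two_le_card_field by blast
  moreover have "real (tuple_count CARD('k) (vec.dim A) (vec.dim B) d) =
      real (card (meeting_subspaces A B Y d)) *
      real (tuple_count CARD('k) (vec.dim Y + d) (vec.dim Y) d)"
    using tuple_count_eq_card_meeting_subspaces_mult[OF assms] by (metis of_nat_mult)
  ultimately show ?thesis by (simp add: meeting_count_def field_simps)
qed

definition profiled_subspaces ::
  "(nat \<Rightarrow> ('k::field^'n) set) \<Rightarrow> (nat \<Rightarrow> nat) \<Rightarrow> nat \<Rightarrow> ('k^'n) set set" where
  "profiled_subspaces A x s =
    {Z. vec.subspace Z \<and> A 0 \<subseteq> Z \<and> Z \<subseteq> A s \<and> (\<forall>i\<le>s. vec.dim (Z \<inter> A i) = x i)}"

lemma profiled_subspaces_Suc_fiber: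
  assumes mA: "mono A" and mx: "x s \<le> x (Suc s)" and Y: "Y \<in> profiled_subspaces A x s"
  shows "{Z \<in> profiled_subspaces A x (Suc s). Z \<inter> A s = Y} =
    meeting_subspaces (A (Suc s)) (A s) Y (x (Suc s) - x s)"
proof -
  have A0Y: "A 0 \<subseteq> Y" and YA: "Y \<subseteq> A s"
    and dY: "\<And>i. i \<le> s \<Longrightarrow> vec.dim (Y \<inter> A i) = x i"
    using Y by (auto simp: profiled_subspaces_def)
  have dYs: "vec.dim Y = x s" using dY[of s] YA by (simp add: Int_absorb2)
  show ?thesis
  proof (rule set_eqI, rule iffI)
    fix Z assume "Z \<in> {Z \<in> profiled_subspaces A x (Suc s). Z \<inter> A s = Y}"
    then have Z: "vec.subspace Z" "Z \<subseteq> A (Suc s)"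
      "vec.dim (Z \<inter> A (Suc s)) = x (Suc s)" "Z \<inter> A s = Y"
      by (auto simp: profiled_subspaces_def)
    have "vec.dim Z = x (Suc s)" using Z(2,3) by (simp add: Int_absorb2)
    then show "Z \<in> meeting_subspaces (A (Suc s)) (A s) Y (x (Suc s) - x s)"
      using Z dYs mx by (auto simp: meeting_subspaces_def)
  next
    fix Z assume "Z \<in> meeting_subspaces (A (Suc s)) (A s) Y (x (Suc s) - x s)"
    then have Z: "vec.subspace Z" "Y \<subseteq> Z" "Z \<subseteq> A (Suc s)" "Z \<inter> A s = Y"
      "vec.dim Z = vec.dim Y + (x (Suc s) - x s)"
      by (auto simp: meeting_subspaces_def)
    have "vec.dim (Z \<inter> A i) = x i" if i: "i \<le> Suc s" for i
    proof (cases "i = Suc s")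
      case True then show ?thesis using Z(3,5) dYs mx by (simp add: Int_absorb2)
    next
      case False
      then have "i \<le> s" using i by simp
      then have "Z \<inter> A i = Y \<inter> A i" using Z(4) monoD[OF mA, of i s] by blast
      then show ?thesis using dY \<open>i \<le> s\<close> by simp
    qed
    then show "Z \<in> {Z \<in> profiled_subspaces A x (Suc s). Z \<inter> A s = Y}"
      using Z A0Y by (auto simp: profiled_subspaces_def)
  qed
qed

lemma card_profiled_subspaces:
  fixes A :: "nat \<Rightarrow> ('k::{field,finite}^'n) set"
  assumes sA: "\<And>i. vec.subspace (A i)" and mA: "\<And>i. A i \<subseteq> A (Suc i)"
    and mx: "\<And>i. x i \<le> x (Suc i)" and x0: "x 0 = vec.dim (A 0)"
  shows "real (card (profiled_subspaces A x s)) =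
    (\<Prod>i<s. meeting_count CARD('k) (vec.dim (A (Suc i))) (vec.dim (A i)) (x i) (x (Suc i) - x i))"
proof (induction s)
  case 0
  have "profiled_subspaces A x 0 = {A 0}" using sA x0 by (auto simp: profiled_subspaces_def)
  then show ?case by simp
next
  case (Suc s)
  have mono: "mono A" using mA by (simp add: mono_iff_le_Suc)
  have "real (card (profiled_subspaces A x (Suc s))) = real (card (profiled_subspaces A x s)) *
      meeting_count CARD('k) (vec.dim (A (Suc s))) (vec.dim (A s)) (x s) (x (Suc s) - x s)"
  proof (rule real_card_eq_by_constant_fibers[where g="\<lambda>Z. Z \<inter> A s"])
    show "(\<lambda>Z. Z \<inter> A s) ` profiled_subspaces A x (Suc s)
        \<subseteq> profiled_subspaces A x s"
    proof
      fix Y assume "Y \<in> (\<lambda>Z. Z \<inter> A s) ` profiled_subspaces A x (Suc s)"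
      then obtain Z where Z: "Z \<in> profiled_subspaces A x (Suc s)" "Y = Z \<inter> A s" by auto
      have "Y \<inter> A i = Z \<inter> A i" if "i \<le> s" for i using Z(2) monoD[OF mono that]
        by blast
      then show "Y \<in> profiled_subspaces A x s"
        using Z sA monoD[OF mono, of 0 s] by (auto simp: profiled_subspaces_def vec.subspace_inter)
    qed
  next
    fix Y assume Y: "Y \<in> profiled_subspaces A x s"
    then have "vec.subspace Y" "Y \<subseteq> A s" "vec.dim Y = x s"
      by (auto simp: profiled_subspaces_def) (metis Int_absorb2 order_refl)
    then show "real (card {Z \<in> profiled_subspaces A x (Suc s). Z \<inter> A s = Y}) =
        meeting_count CARD('k) (vec.dim (A (Suc s))) (vec.dim (A s)) (x s) (x (Suc s) - x s)"
      using profiled_subspaces_Suc_fiber[OF mono mx Y] card_meeting_subspaces[OF sA sA _ _ mA]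
        by simp
  qed simp_all
  then show ?case using Suc by simp
qed

lemma qint_pos: "0 < q \<Longrightarrow> 1 \<le> i \<Longrightarrow> 0 < qint q i"
  unfolding qint_def by (intro sum_pos2[of _ 0]) auto

lemma qfact_pos: "0 < q \<Longrightarrow> 0 < qfact q m"
  unfolding qfact_def by (intro prod_pos qint_pos) auto

lemma qfact_Suc: "qfact q (Suc m) = qfact q m * qint q (Suc m)"
  by (simp add: qfact_def)

lemma qfact_split:
  "d \<le> m \<Longrightarrow> qfact q m = qfact q (m - d) * (\<Prod>j<d. qint q (m - j))"
proof (induction d)
  case 0 then show ?case by simp
next
  case (Suc d)
  have "qfact q (m - d) = qfact q (m - Suc d) * qint q (m - d)"
    using Suc.prems qfact_Suc[of q "m - Suc d"] by (simp add: Suc_diff_Suc)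
  then show ?case using Suc by (simp add: mult.assoc)
qed

lemma qbinom_prod:
  assumes "0 < q" "d \<le> m"
  shows "qbinom q m d = (\<Prod>j<d. qint q (m - j)) / (\<Prod>j<d. qint q (d - j))"
proof -
  have a: "qfact q d = (\<Prod>j<d. qint q (d - j))" using qfact_split[of d d q]
    by (simp add: qfact_def)
  show ?thesis using qfact_split[OF assms(2), of q] a qfact_pos[OF assms(1), of "m - d"] assms(2)
    by (simp add: qbinom_def)
qed

lemma qbinom_0: "0 < q \<Longrightarrow> qbinom q m 0 = 1"
  using qfact_pos[of q m] by (simp add: qbinom_def qfact_def[of q 0])

lemma qbinom_sym: "r \<le> m \<Longrightarrow> qbinom q m (m - r) = qbinom q m r"
  by (simp add: qbinom_def mult.commute)

lemma power_diff_eq_qint: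
  fixes Q :: real assumes Q: "1 < Q"
  shows "Q ^ (b + r) - Q ^ b = Q ^ (b + r) * (1 - 1 / Q) * qint (1 / Q) r"
proof -
  have "qint (1/Q) r = (1 - (1/Q) ^ r) / (1 - 1/Q)" unfolding qint_def
    using Q by (subst sum_gp_strict) auto
  moreover have "1 - 1/Q \<noteq> 0" using Q by simp
  ultimately have "(1 - 1 / Q) * qint (1 / Q) r = 1 - (1/Q)^r" by simp
  moreover have "Q ^ (b + r) * (1/Q)^r = Q ^ b" using Q by (simp add: power_add power_one_over)
  ultimately have "Q ^ (b + r) * ((1 - 1 / Q) * qint (1 / Q) r) = Q ^ (b + r) - Q ^ b"
    by (simp add: right_diff_distrib)
  then show ?thesis by (simp only: mult.assoc)
qed

lemma real_tuple_count_eq: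
  assumes Q: "2 \<le> Q" and d: "b + d \<le> a"
  shows "real (tuple_count Q a b d) =
    real Q ^ (a * d) * (1 - 1 / real Q) ^ d * (\<Prod>j<d. qint (1 / real Q) (a - b - j))"
proof -
  have "real (Q ^ a - Q ^ (b + j)) = real Q ^ a * (1 - 1 / real Q) * qint (1 / real Q) (a - b - j)"
    if "j < d" for j
  proof -
    have "b + j + (a - b - j) = a" using that d by simp
    moreover have "Q ^ (b + j) \<le> Q ^ a" using that d Q by (intro power_increasing) auto
    ultimately show ?thesis
      using power_diff_eq_qint[of "real Q" "b + j" "a - b - j"] Q by (simp add: of_nat_diff)
  qed
  then have "real (tuple_count Q a b d) =
      (\<Prod>j<d. real Q ^ a * (1 - 1 / real Q) * qint (1 / real Q) (a - b - j))"
    unfolding tuple_count_def of_nat_prod by (intro prod.cong) auto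
  then show ?thesis by (simp add: prod.distrib power_mult_distrib power_mult mult.commute)
qed

lemma meeting_count_eq:
  assumes Q: "2 \<le> Q" and ba: "b \<le> a"
  shows "meeting_count Q a b y d =
    real Q ^ (a * d) / real Q ^ ((y + d) * d) * qbinom (1 / real Q) (a - b) d"
proof (cases "d \<le> a - b")
  case True
  have q0: "0 < 1 / real Q" using Q by simp
  have "0 < (\<Prod>j<d. qint (1 / real Q) (d - j))" using q0 by (intro prod_pos qint_pos) auto
  moreover have "0 < (1 - 1 / real Q) ^ d" "0 < real Q ^ ((y + d) * d)" using Q by simp_all
  moreover have den: "real (tuple_count Q (y + d) y d) =
      real Q ^ ((y + d) * d) * (1 - 1 / real Q) ^ d * (\<Prod>j<d. qint (1 / real Q) (d - j))"
    using real_tuple_count_eq[OF Q, of y d "y + d"] by simp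
  moreover have num: "real (tuple_count Q a b d) =
      real Q ^ (a * d) * (1 - 1 / real Q) ^ d * (\<Prod>j<d. qint (1 / real Q) (a - b - j))"
    using real_tuple_count_eq[OF Q] True ba by simp
  ultimately show ?thesis
    unfolding meeting_count_def num den qbinom_prod[OF q0 True] using Q by (simp add: field_simps)
next
  case False
  then have "tuple_count Q a b d = 0" unfolding tuple_count_def using ba
    by (intro prod_zero) (auto intro!: bexI[of _ "a - b"])
  moreover have "qbinom (1 / real Q) (a - b) d = 0" using False by (simp add: qbinom_def)
  ultimately show ?thesis by (simp add: meeting_count_def)
qed

text \<open>
  One layer of card_subspaces_of_type: Di, D1, D2 are the dimensions of U \<inter> ker N^j for
  j = i, i+1, i+2, u = dim U, lam1, lam2, mu1 are the parts i+1, i+2, i+1 of the two shapes,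
  Mi = psum mu i, a0, a1 are the dimensions of two consecutive spaces of the filtration and
  x0, x1 the prescribed dimensions of their intersections with W.
\<close>

lemma meeting_count_eq_qbinom:
  fixes Di D1 D2 u Mi mu1 lam1 lam2 a0 a1 x0 x1 :: nat
  assumes Q: "2 \<le> Q"
    and D: "Di \<le> D1" "D1 \<le> D2" "D2 \<le> u"
    and lam: "lam1 = D1 - Di" "lam2 = D2 - D1" "lam2 \<le> mu1" "mu1 \<le> lam1" "Mi \<le> Di"
    and a: "a0 + D1 = Di + u" "a1 + D2 = D1 + u"
    and x: "x0 = Mi + u - D1" "x1 = (Mi + mu1) + u - D2"
  shows "meeting_count Q a1 a0 x0 (x1 - x0) =
     real Q ^ ((mu1 - lam2) * (D1 - (Mi + mu1))) * qbinom (1 / real Q) (lam1 - lam2) (lam1 - mu1)"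
proof -
  have ba: "a0 \<le> a1" using D a lam by linarith
  have dd: "x1 - x0 = mu1 - lam2" using D lam x by linarith
  have xd: "x0 + (mu1 - lam2) = x1" using D lam x by linarith
  have aa: "a1 - a0 = lam1 - lam2" using D lam a by linarith
  have ax: "a1 - x1 = D1 - (Mi + mu1)" "x1 \<le> a1" using D lam a x by linarith+
  have sym: "qbinom (1 / real Q) (lam1 - lam2) (mu1 - lam2)
      = qbinom (1 / real Q) (lam1 - lam2) (lam1 - mu1)"
    using qbinom_sym[of "mu1 - lam2" "lam1 - lam2" "1 / real Q"] lam by (simp add: diff_diff_eq2)
  have pw: "real Q ^ (a1 * (mu1 - lam2)) / real Q ^ (x1 * (mu1 - lam2))
      = real Q ^ ((a1 - x1) * (mu1 - lam2))"
  proof -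
    have "a1 * (mu1 - lam2) = x1 * (mu1 - lam2) + (a1 - x1) * (mu1 - lam2)"
      using ax(2) by (simp add: add_mult_distrib[symmetric])
    then show ?thesis using Q by (simp add: power_add)
  qed
  show ?thesis
    unfolding meeting_count_eq[OF Q ba] dd xd aa sym using pw ax(1) by (simp add: mult.commute)
qed

definition psum :: "(nat \<Rightarrow> nat) \<Rightarrow> nat \<Rightarrow> nat" where
  "psum mu i = (\<Sum>j\<in>{1..i}. mu j)"

lemma psum_0[simp]: "psum mu 0 = 0" by (simp add: psum_def)

lemma psum_Suc[simp]: "psum mu (Suc i) = psum mu i + mu (Suc i)" by (simp add: psum_def)

lemma choose_two_int: "2 * int (n choose 2) = int n * (int n - 1)"
proof (induction n)
  case 0 then show ?case by simp
next
  case (Suc n)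
  have "Suc n choose 2 = n + (n choose 2)"
    using binomial_Suc_Suc[of n 1] by (simp add: numeral_2_eq_2)
  then show ?case using Suc by (simp add: algebra_simps)
qed

lemma exponent_identity_aux:
  fixes lam mu :: "nat \<Rightarrow> nat"
  shows "2 * (\<Sum>i<s. (int (mu (Suc i)) - int (lam (Suc (Suc i)))) *
        (int (psum lam (Suc i)) - int (psum mu (Suc i)))) +
      2 * int (lam (Suc s)) * (int (psum lam s) - int (psum mu s)) =
    (\<Sum>j<s. int (lam (Suc j)) * (int (lam (Suc j)) - 1) -
        int (mu (Suc j)) * (int (mu (Suc j)) - 1)) -
      (int (psum lam s) - int (psum mu s)) * (int (psum lam s) - int (psum mu s) - 1)"
proof (induction s)
  case 0 then show ?case by simp
next
  case (Suc s)
  then show ?case by (simp add: algebra_simps)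
qed

lemma exponent_identity:
  fixes lam mu :: "nat \<Rightarrow> nat"
  assumes "lam (Suc m) = 0"
    and "\<And>i. lam (Suc (Suc i)) \<le> mu (Suc i)"
    and "\<And>i. mu (Suc i) \<le> lam (Suc i)"
  shows "int (\<Sum>i<m. (mu (Suc i) - lam (Suc (Suc i))) * (psum lam (Suc i) - psum mu (Suc i)))
     = (\<Sum>j<m. int (lam (Suc j) choose 2)) - (\<Sum>j<m. int (mu (Suc j) choose 2))
       - int ((psum lam m - psum mu m) choose 2)"
proof -
  have Mle: "psum mu s \<le> psum lam s" for s
    unfolding psum_def
      by (intro sum_mono) (metis assms(3) Suc_pred atLeastAtMost_iff not_one_le_zero neq0_conv)
  have e1: "int (\<Sum>i<m. (mu (Suc i) - lam (Suc (Suc i))) * (psum lam (Suc i) - psum mu (Suc i))) =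
    (\<Sum>i<m. (int (mu (Suc i)) - int (lam (Suc (Suc i)))) *
      (int (psum lam (Suc i)) - int (psum mu (Suc i))))"
  proof -
    have "int ((mu (Suc i) - lam (Suc (Suc i))) * (psum lam (Suc i) - psum mu (Suc i))) =
      (int (mu (Suc i)) - int (lam (Suc (Suc i)))) * (int (psum lam (Suc i)) - int (psum mu (Suc i)))"
      for i
      using assms(2)[of i] Mle[of "Suc i"] by (simp only: of_nat_mult of_nat_diff)
    then show ?thesis by (simp only: of_nat_sum)
  qed
  have e2: "2 * (\<Sum>j<m. int (lam (Suc j) choose 2)) - 2 * (\<Sum>j<m. int (mu (Suc j) choose 2))
       - 2 * int ((psum lam m - psum mu m) choose 2)
     = (\<Sum>j<m. int (lam (Suc j)) * (int (lam (Suc j)) - 1) -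
          int (mu (Suc j)) * (int (mu (Suc j)) - 1)) -
       (int (psum lam m) - int (psum mu m)) * (int (psum lam m) - int (psum mu m) - 1)"
    using Mle[of m] by (simp add: sum_distrib_left choose_two_int sum_subtractf of_nat_diff)
  show ?thesis using exponent_identity_aux[of mu lam m] assms(1) e1 e2 by simp
qed

lemma mat_funpow_zero: "((*v) (N::'k::field^'n^'n) ^^ i) 0 = 0"
  by (induction i) auto

lemma ker_pow_0: "ker_pow N 0 = {0}" by (auto simp: ker_pow_def)

lemma ker_pow_Suc_iff: "x \<in> ker_pow N (Suc i) \<longleftrightarrow> N *v x \<in> ker_pow N i"
  by (simp add: ker_pow_def funpow_Suc_right del: funpow.simps)

lemma ker_pow_mono_Suc: "ker_pow (N::'k::field^'n^'n) i \<subseteq> ker_pow N (Suc i)"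
  by (auto simp: ker_pow_def)

lemma ker_pow_mono:
  "i \<le> j \<Longrightarrow> ker_pow (N::'k::field^'n^'n) i \<subseteq> ker_pow N j"
  using lift_Suc_mono_le[of "ker_pow N", OF ker_pow_mono_Suc] by blast

lemma ker_pow_eq_UNIV:
  assumes "((*v) (N::'k::field^'n^'n) ^^ m) = (\<lambda>x. 0)" "m \<le> i"
  shows "ker_pow N i = UNIV"
proof -
  have "((*v) N ^^ i) x = 0" for x
  proof -
    have "((*v) N ^^ i) = ((*v) N ^^ (i - m)) \<circ> ((*v) N ^^ m)"
      using assms(2) by (metis funpow_add le_add_diff_inverse2)
    then show ?thesis using assms(1) mat_funpow_zero by simp
  qed
  then show ?thesis by (auto simp: ker_pow_def)
qed

lemma image_Int_ker_pow: "(*v) N ` U \<inter> ker_pow N i = (*v) N ` (U \<inter> ker_pow N (Suc i))"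
  by (auto simp: ker_pow_Suc_iff)

lemma JF_on_0[simp]: "JF_on W N 0 = 0" by (simp add: JF_on_def)

lemma JF_on_Suc:
  "JF_on U N (Suc i) = vec.dim (U \<inter> ker_pow N (Suc i)) - vec.dim (U \<inter> ker_pow N i)"
  by (simp add: JF_on_def)

lemma dim_Int_ker_pow_0: "vec.dim (W \<inter> ker_pow (N::'k::field^'n^'n) 0) = 0"
  by (simp add: ker_pow_0)

lemma dim_Int_ker_pow_mono:
  "vec.dim (U \<inter> ker_pow (N::'k::field^'n^'n) i) \<le> vec.dim (U \<inter> ker_pow N (Suc i))"
  by (intro vec.dim_subset) (use ker_pow_mono_Suc[of N i] in blast)

lemma psum_JF_on: "psum (JF_on U (N::'k::field^'n^'n)) i = vec.dim (U \<inter> ker_pow N i)"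
proof (induction i)
  case 0 then show ?case using dim_Int_ker_pow_0 by simp
next
  case (Suc i) then show ?case using dim_Int_ker_pow_mono[of U N i] by (simp add: JF_on_Suc)
qed

lemma dim_eq_psum_JF_on:
  assumes nil: "((*v) (N::'k::field^'n^'n) ^^ m) = (\<lambda>x. 0)"
  shows "vec.dim W = psum (JF_on W N) m"
  using psum_JF_on[of W N m] ker_pow_eq_UNIV[OF nil order_refl] by simp

lemma JF_on_vanish:
  fixes N :: "'k::field^'n^'n"
  assumes nil: "((*v) N ^^ m) = (\<lambda>x. 0)" "m < j"
  shows "JF_on W N j = 0"
  using ker_pow_eq_UNIV[OF nil(1), of j] ker_pow_eq_UNIV[OF nil(1), of "j - 1"] nil(2)
  by (simp add: JF_on_def)

lemma JF_on_eq_iff_dims: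
  fixes N :: "'k::field^'n^'n"
  assumes nil: "((*v) N ^^ m) = (\<lambda>x. 0)" and mu0: "mu 0 = 0"
    and mum: "\<And>j. m < j \<Longrightarrow> mu j = 0"
  shows "JF_on W N = mu
      \<longleftrightarrow> (\<forall>i\<le>m. vec.dim (W \<inter> ker_pow N i) = psum mu i)"
proof
  assume "JF_on W N = mu"
  then show "\<forall>i\<le>m. vec.dim (W \<inter> ker_pow N i) = psum mu i" using psum_JF_on
    by metis
next
  assume H: "\<forall>i\<le>m. vec.dim (W \<inter> ker_pow N i) = psum mu i"
  show "JF_on W N = mu"
  proof
    fix i show "JF_on W N i = mu i"
    proof (cases i)
      case 0 then show ?thesis using mu0 by simp
    next
      case (Suc j)
      show ?thesis
      proof (cases "Suc j \<le> m")
        case True then show ?thesis using H Suc by (simp add: JF_on_Suc)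
      next
        case False then show ?thesis using JF_on_vanish[OF nil] mum Suc by simp
      qed
    qed
  qed
qed

definition image_filtration :: "'k::field^'n^'n \<Rightarrow> ('k^'n) set \<Rightarrow> nat \<Rightarrow> ('k^'n) set" where
  "image_filtration N U i = {x + y |x y. x \<in> U \<inter> ker_pow N i \<and> y \<in> (*v) N ` U}"

definition subspaces_of_type ::
  "'k::field^'n^'n \<Rightarrow> ('k^'n) set \<Rightarrow> (nat \<Rightarrow> nat) \<Rightarrow> ('k^'n) set set" where
  "subspaces_of_type N U mu
      = {W. vec.subspace W \<and> (*v) N ` U \<subseteq> W \<and> W \<subseteq> U \<and> JF_on W N = mu}"

text \<open>
  For N U \<subseteq> W \<subseteq> U with JF_on W N = mu, type_profile N U mu i is the dimension of
  W \<inter> image_filtration N U i (by dim_Int_image_filtration).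
\<close>

definition type_profile :: "'k::field^'n^'n \<Rightarrow> ('k^'n) set \<Rightarrow> (nat \<Rightarrow> nat) \<Rightarrow> nat \<Rightarrow> nat" where
  "type_profile N U mu i = psum mu i + vec.dim U - vec.dim (U \<inter> ker_pow N (Suc i))"

context
  fixes N :: "'k::{field,finite}^'n^'n" and U :: "('k^'n) set"
  assumes sU: "vec.subspace U" and NUU: "(*v) N ` U \<subseteq> U"
begin

lemma subspace_Int_ker_pow: "vec.subspace (U \<inter> ker_pow N i)"
  using sU subspace_ker_pow vec.subspace_inter by blast

lemma subspace_image_filtration: "vec.subspace (image_filtration N U i)"
  unfolding image_filtration_def
    by (rule vec.subspace_sums[OF subspace_Int_ker_pow subspace_mat_image[OF sU, of N]])

lemma image_filtration_mono: "image_filtration N U i \<subseteq> image_filtration N U (Suc i)"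
  unfolding image_filtration_def using ker_pow_mono_Suc by blast

lemma image_filtration_0: "image_filtration N U 0 = (*v) N ` U"
proof -
  have "0 \<in> U" using sU vec.subspace_0 by blast
  then show ?thesis unfolding image_filtration_def ker_pow_0 by force
qed

lemma image_filtration_subset: "image_filtration N U i \<subseteq> U"
  unfolding image_filtration_def using NUU sU vec.subspace_add by blast

lemma image_filtration_eq:
  assumes "((*v) N ^^ m) = (\<lambda>x. 0)" "m \<le> i"
  shows "image_filtration N U i = U"
proof
  show "image_filtration N U i \<subseteq> U" by (rule image_filtration_subset)
  show "U \<subseteq> image_filtration N U i"
  proof
    fix u assume "u \<in> U"
    moreover have "0 \<in> (*v) N ` U" using sU vec.subspace_0
      by (metis image_eqI matrix_vector_mult_0_right)
    ultimately show "u \<in> image_filtration N U i"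
      unfolding image_filtration_def ker_pow_eq_UNIV[OF assms] by force
  qed
qed

lemma dim_image_Int_ker_pow:
  "vec.dim ((*v) N ` U \<inter> ker_pow N i) + vec.dim (U \<inter> ker_pow N 1) =
    vec.dim (U \<inter> ker_pow N (Suc i))"
proof -
  have "(U \<inter> ker_pow N (Suc i)) \<inter> ker_pow N 1 = U \<inter> ker_pow N 1"
    using ker_pow_mono[of 1 "Suc i" N] by auto
  then show ?thesis
    using dim_image_plus_dim_kernel[OF subspace_Int_ker_pow, of N "Suc i"] image_Int_ker_pow
      by metis
qed

lemma dim_Int_image_filtration:
  assumes W: "vec.subspace W" "(*v) N ` U \<subseteq> W" "W \<subseteq> U"
  shows "vec.dim (W \<inter> image_filtration N U i) + vec.dim (U \<inter> ker_pow N (Suc i))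
      = vec.dim (W \<inter> ker_pow N i) + vec.dim U"
proof -
  have sWK: "vec.subspace (W \<inter> ker_pow N i)" using W(1) subspace_ker_pow vec.subspace_inter
    by blast
  have e1: "W \<inter> image_filtration N U i
      = {x + y |x y. x \<in> W \<inter> ker_pow N i \<and> y \<in> (*v) N ` U}"
  proof
    show "W \<inter> image_filtration N U i
        \<subseteq> {x + y |x y. x \<in> W \<inter> ker_pow N i \<and> y \<in> (*v) N ` U}"
    proof
      fix z assume z: "z \<in> W \<inter> image_filtration N U i"
      then obtain x y where xy: "x \<in> U \<inter> ker_pow N i" "y \<in> (*v) N ` U" "z = x + y"
        unfolding image_filtration_def by blast
      have "x = z - y" using xy by simp
      then have "x \<in> W" using z xy(2) W vec.subspace_diff by (metis IntD1 subsetD)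
      then show "z \<in> {x + y |x y. x \<in> W \<inter> ker_pow N i \<and> y \<in> (*v) N ` U}"
        using xy by blast
    qed
    show "{x + y |x y. x \<in> W \<inter> ker_pow N i \<and> y \<in> (*v) N ` U}
        \<subseteq> W \<inter> image_filtration N U i"
      unfolding image_filtration_def using W vec.subspace_add by blast
  qed
  have e2: "(W \<inter> ker_pow N i) \<inter> (*v) N ` U = (*v) N ` U \<inter> ker_pow N i" using W
    by blast
  have "vec.dim (W \<inter> image_filtration N U i) + vec.dim ((*v) N ` U \<inter> ker_pow N i)
      = vec.dim (W \<inter> ker_pow N i) + vec.dim ((*v) N ` U)"
    using vec.dim_sums_Int[OF sWK subspace_mat_image[OF sU, of N]] e1 e2 by simp
  then show ?thesis using dim_image_plus_dim_kernel[OF sU, of N] dim_image_Int_ker_pow[of i]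
    by linarith
qed

lemma dim_image_filtration:
  "vec.dim (image_filtration N U i) + vec.dim (U \<inter> ker_pow N (Suc i)) =
    vec.dim (U \<inter> ker_pow N i) + vec.dim U"
  using dim_Int_image_filtration[OF sU NUU order_refl, of i] image_filtration_subset[of i]
    by (simp add: Int_absorb1)

lemma dim_Int_ker_pow_le: "vec.dim (U \<inter> ker_pow N i) \<le> vec.dim U"
  by (rule vec.dim_subset) blast

lemma subspaces_of_type_eq_profiled:
  assumes nil: "((*v) N ^^ m) = (\<lambda>x. 0)" and mu0: "mu 0 = 0"
    and mum: "\<And>j. m < j \<Longrightarrow> mu j = 0"
  shows "subspaces_of_type N U mu
      = profiled_subspaces (image_filtration N U) (type_profile N U mu) m"
proof (rule set_eqI)
  fix W
  show "W \<in> subspaces_of_type N U mu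
      \<longleftrightarrow> W \<in> profiled_subspaces (image_filtration N U) (type_profile N U mu) m"
  proof (cases "vec.subspace W \<and> (*v) N ` U \<subseteq> W \<and> W \<subseteq> U")
    case False
    then show ?thesis
      using image_filtration_0 image_filtration_eq[OF nil order_refl]
        by (auto simp: subspaces_of_type_def profiled_subspaces_def)
  next
    case True
    then have W: "vec.subspace W" "(*v) N ` U \<subseteq> W" "W \<subseteq> U" by auto
    have "vec.dim (W \<inter> image_filtration N U i) = type_profile N U mu i
        \<longleftrightarrow> vec.dim (W \<inter> ker_pow N i) = psum mu i" for i
      using dim_Int_image_filtration[OF W, of i] dim_Int_ker_pow_le[of "Suc i"]
        unfolding type_profile_def by linarith
    then have "JF_on W N = mu
        \<longleftrightarrow> (\<forall>i\<le>m. vec.dim (W \<inter> image_filtration N U i) = type_profile N U mu i)"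
      using JF_on_eq_iff_dims[where N=N and m=m and mu=mu, OF nil mu0 mum] by simp
    then show ?thesis using W image_filtration_0 image_filtration_eq[OF nil order_refl]
      by (auto simp: subspaces_of_type_def profiled_subspaces_def)
  qed
qed

lemma card_subspaces_of_type_prod:
  assumes nil: "((*v) N ^^ m) = (\<lambda>x. 0)" and mu0: "mu 0 = 0"
    and mum: "\<And>j. m < j \<Longrightarrow> mu j = 0"
    and inter: "\<And>i. vec.dim (U \<inter> ker_pow N (Suc (Suc i))) \<le>
      mu (Suc i) + vec.dim (U \<inter> ker_pow N (Suc i))"
  shows "real (card (subspaces_of_type N U mu)) =
    (\<Prod>i<m. meeting_count CARD('k)
      (vec.dim (image_filtration N U (Suc i))) (vec.dim (image_filtration N U i))
      (type_profile N U mu i) (type_profile N U mu (Suc i) - type_profile N U mu i))"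
proof -
  have "real (card (profiled_subspaces (image_filtration N U) (type_profile N U mu) m)) =
    (\<Prod>i<m. meeting_count CARD('k)
      (vec.dim (image_filtration N U (Suc i))) (vec.dim (image_filtration N U i))
      (type_profile N U mu i) (type_profile N U mu (Suc i) - type_profile N U mu i))"
  proof (rule card_profiled_subspaces)
    show "vec.subspace (image_filtration N U i)" for i by (rule subspace_image_filtration)
    show "image_filtration N U i \<subseteq> image_filtration N U (Suc i)" for i
      by (rule image_filtration_mono)
    show "type_profile N U mu i \<le> type_profile N U mu (Suc i)" for i
      using inter[of i] dim_Int_ker_pow_le[of "Suc i"] dim_Int_ker_pow_le[of "Suc (Suc i)"]
      unfolding type_profile_def by simp
    show "type_profile N U mu 0 = vec.dim (image_filtration N U 0)"
      using image_filtration_0 dim_image_plus_dim_kernel[OF sU, of N]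
      unfolding type_profile_def by simp
  qed
  then show ?thesis using subspaces_of_type_eq_profiled[where m=m and mu=mu, OF nil mu0 mum] by simp
qed

lemma card_subspaces_of_type:
  assumes nil: "((*v) N ^^ m) = (\<lambda>x. 0)" and mu0: "mu 0 = 0"
    and mum: "\<And>j. m < j \<Longrightarrow> mu j = 0"
    and i1: "\<And>i. JF_on U N (Suc (Suc i)) \<le> mu (Suc i)"
    and i2: "\<And>i. mu (Suc i) \<le> JF_on U N (Suc i)"
  shows "real (card (subspaces_of_type N U mu)) =
    real CARD('k) ^
      (\<Sum>i<m. (mu (Suc i) - JF_on U N (Suc (Suc i))) *
        (psum (JF_on U N) (Suc i) - psum mu (Suc i))) *
    (\<Prod>i<m. qbinom (1 / real CARD('k))
      (JF_on U N (Suc i) - JF_on U N (Suc (Suc i))) (JF_on U N (Suc i) - mu (Suc i)))"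
proof -
  let ?Q = "CARD('k)" and ?lam = "JF_on U N" and ?D = "\<lambda>i. vec.dim (U \<inter> ker_pow N i)"
  let ?a = "\<lambda>i. vec.dim (image_filtration N U i)" and ?x = "type_profile N U mu"
  have Mle: "psum mu s \<le> ?D s" for s
    using sum_mono[of "{1..s}" mu ?lam] i2 psum_JF_on[of U N s] unfolding psum_def
    by (metis Suc_pred atLeastAtMost_iff not_one_le_zero neq0_conv)
  have inter: "?D (Suc (Suc i)) \<le> mu (Suc i) + ?D (Suc i)" for i
    using i1[of i] dim_Int_ker_pow_mono[of U N "Suc i"] by (simp add: JF_on_Suc)
  have factor: "meeting_count ?Q (?a (Suc i)) (?a i) (?x i) (?x (Suc i) - ?x i) =
      real ?Q ^ ((mu (Suc i) - ?lam (Suc (Suc i))) * (psum ?lam (Suc i) - psum mu (Suc i))) *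
      qbinom (1 / real ?Q) (?lam (Suc i) - ?lam (Suc (Suc i))) (?lam (Suc i) - mu (Suc i))" for i
  proof -
    have "meeting_count ?Q (?a (Suc i)) (?a i) (?x i) (?x (Suc i) - ?x i) =
      real ?Q ^ ((mu (Suc i) - ?lam (Suc (Suc i))) * (?D (Suc i) - (psum mu i + mu (Suc i)))) *
      qbinom (1 / real ?Q) (?lam (Suc i) - ?lam (Suc (Suc i))) (?lam (Suc i) - mu (Suc i))"
    proof (rule meeting_count_eq_qbinom[OF two_le_card_field])
      show "?D i \<le> ?D (Suc i)" "?D (Suc i) \<le> ?D (Suc (Suc i))"
        by (rule dim_Int_ker_pow_mono)+
      show "?D (Suc (Suc i)) \<le> vec.dim U" by (rule dim_Int_ker_pow_le)
      show "?lam (Suc i) = ?D (Suc i) - ?D i" "?lam (Suc (Suc i)) = ?D (Suc (Suc i)) - ?D (Suc i)"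
        by (simp_all add: JF_on_Suc)
      show "?lam (Suc (Suc i)) \<le> mu (Suc i)" "mu (Suc i) \<le> ?lam (Suc i)" by (rule i1, rule i2)
      show "psum mu i \<le> ?D i" by (rule Mle)
      show "?a i + ?D (Suc i) = ?D i + vec.dim U"
        "?a (Suc i) + ?D (Suc (Suc i)) = ?D (Suc i) + vec.dim U"
        by (rule dim_image_filtration)+
      show "?x i = psum mu i + vec.dim U - ?D (Suc i)"
        "?x (Suc i) = (psum mu i + mu (Suc i)) + vec.dim U - ?D (Suc (Suc i))"
        unfolding type_profile_def by simp_all
    qed
    then show ?thesis unfolding psum_JF_on by (simp only: psum_Suc)
  qed
  have "real (card (subspaces_of_type N U mu)) =
      (\<Prod>i<m. meeting_count ?Q (?a (Suc i)) (?a i) (?x i) (?x (Suc i) - ?x i))"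
    by (rule card_subspaces_of_type_prod[OF nil mu0 mum inter])
  also have "\<dots> = (\<Prod>i<m. real ?Q ^ ((mu (Suc i) - ?lam (Suc (Suc i))) *
      (psum ?lam (Suc i) - psum mu (Suc i))) *
      qbinom (1 / real ?Q) (?lam (Suc i) - ?lam (Suc (Suc i))) (?lam (Suc i) - mu (Suc i)))"
    using factor by simp
  finally show ?thesis by (simp add: prod.distrib power_sum del: psum_Suc)
qed

lemma JF_on_interlace:
  assumes W: "vec.subspace W" "(*v) N ` U \<subseteq> W" "W \<subseteq> U"
  shows "JF_on U N (Suc (Suc i)) \<le> JF_on W N (Suc i)"
    "JF_on W N (Suc i) \<le> JF_on U N (Suc i)"
proof -
  let ?D = "\<lambda>i. vec.dim (U \<inter> ker_pow N i)"
  let ?E = "\<lambda>i. vec.dim (W \<inter> ker_pow N i)"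
  let ?x = "\<lambda>i. vec.dim (W \<inter> image_filtration N U i)"
  let ?a = "\<lambda>i. vec.dim (image_filtration N U i)"
  have w0: "?x i + ?D (Suc i) = ?E i + vec.dim U"
    and w1: "?x (Suc i) + ?D (Suc (Suc i)) = ?E (Suc i) + vec.dim U"
    using dim_Int_image_filtration[OF W] by blast+
  have a0: "?a i + ?D (Suc i) = ?D i + vec.dim U"
    and a1: "?a (Suc i) + ?D (Suc (Suc i)) = ?D (Suc i) + vec.dim U"
    using dim_image_filtration by blast+
  have xm: "?x i \<le> ?x (Suc i)"
    by (intro vec.dim_subset) (use image_filtration_mono[of i] in blast)
  have sWA: "vec.subspace (W \<inter> image_filtration N U (Suc i))"
    using W(1) subspace_image_filtration vec.subspace_inter by blast
  have sA: "vec.subspace (image_filtration N U i)" using subspace_image_filtration .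
  let ?S = "{x + y |x y. x \<in> W \<inter> image_filtration N U (Suc i) \<and> y \<in> image_filtration N U i}"
  have "?S \<subseteq> image_filtration N U (Suc i)"
    using image_filtration_mono[of i] subspace_image_filtration[of "Suc i"] vec.subspace_add
    by blast
  then have "vec.dim ?S \<le> ?a (Suc i)" by (rule vec.dim_subset)
  moreover have "(W \<inter> image_filtration N U (Suc i)) \<inter> image_filtration N U i
      = W \<inter> image_filtration N U i"
    using image_filtration_mono[of i] by blast
  ultimately have xa: "?x (Suc i) + ?a i \<le> ?a (Suc i) + ?x i"
    using vec.dim_sums_Int[OF sWA sA] by simp
  have dm: "?D i \<le> ?D (Suc i)" "?D (Suc i) \<le> ?D (Suc (Suc i))" "?E i \<le> ?E (Suc i)"
    by (rule dim_Int_ker_pow_mono)+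
  show "JF_on U N (Suc (Suc i)) \<le> JF_on W N (Suc i)"
    unfolding JF_on_Suc using w0 w1 xm dm by linarith
  show "JF_on W N (Suc i) \<le> JF_on U N (Suc i)"
    unfolding JF_on_Suc using w0 w1 a0 a1 xa dm by linarith
qed

end

text \<open>
  Partitions are indexed from 1; m bounds the number of nonzero parts (in the application
  N^m = 0).
\<close>

definition bounded_partition :: "(nat \<Rightarrow> nat) \<Rightarrow> nat \<Rightarrow> bool" where
  "bounded_partition lam m \<longleftrightarrow> lam 0 = 0
      \<and> (\<forall>i. lam (Suc (Suc i)) \<le> lam (Suc i)) \<and> (\<forall>i>m. lam i = 0)"

lemma eq_atLeastAtMost_card:
  assumes "finite S" "\<And>c. c \<in> S \<Longrightarrow> 1 \<le> c"
    "\<And>c c'. c' \<in> S \<Longrightarrow> 1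
        \<le> c \<Longrightarrow> c \<le> c' \<Longrightarrow> c \<in> S"
  shows "S = {1..card S}"
proof (cases "S = {}")
  case True then show ?thesis by simp
next
  case False
  let ?M = "Max S"
  have e: "S = {1..?M}"
  proof
    show "S \<subseteq> {1..?M}" using assms(1,2) by auto
    show "{1..?M} \<subseteq> S" using assms(3)[of ?M] Max_in[OF assms(1) False] by auto
  qed
  have "card {1..?M} = ?M" by simp
  then show ?thesis using e by metis
qed

lemma nat_eq_by_pos_le:
  assumes H: "\<And>c. 1 \<le> c \<Longrightarrow> c \<le> (a::nat)
      \<longleftrightarrow> c \<le> b" shows "a = b"
proof -
  have "a \<le> b" using H[of a] by (cases "a = 0") auto
  moreover have "b \<le> a" using H[of b] by (cases "b = 0") auto
  ultimately show ?thesis by simp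
qed

context
  fixes lam :: "nat \<Rightarrow> nat" and T :: "nat \<Rightarrow> nat \<Rightarrow> nat"
    and m :: nat
  assumes ss: "ssyt lam T" and sh: "bounded_partition lam m"
begin

lemma ssyt_nonzero_iff:
  "T i c \<noteq> 0 \<longleftrightarrow> 1 \<le> i \<and> 1 \<le> c \<and> c \<le> lam i"
  using ss unfolding ssyt_def in_shape_def by blast

lemma ssyt_zero_border: "T 0 c = 0" "T i 0 = 0" using ssyt_nonzero_iff by auto

lemma ssyt_row_step:
  "1 \<le> i \<Longrightarrow> 1 \<le> c \<Longrightarrow> Suc c \<le> lam i \<Longrightarrow> T i c \<le> T i (Suc c)"
  using ss unfolding ssyt_def in_shape_def by auto

lemma ssyt_col_step:
  "1 \<le> c \<Longrightarrow> c \<le> lam (Suc i) \<Longrightarrow> T i c < T (Suc i) c"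
  using ss unfolding ssyt_def in_shape_def by auto

lemma ssyt_row_mono: "1 \<le> c \<Longrightarrow> c \<le> c' \<Longrightarrow> c' \<le> lam i \<Longrightarrow> T i c \<le> T i c'"
proof (induction c' rule: nat_induct)
  case 0 then show ?case by simp
next
  case (Suc n)
  show ?case
  proof (cases "c = Suc n")
    case True then show ?thesis by simp
  next
    case False
    then have "c \<le> n" using Suc by simp
    moreover have "1 \<le> i" using Suc.prems sh by (cases i) (auto simp: bounded_partition_def)
    ultimately show ?thesis using Suc ssyt_row_step[of i n] by fastforce
  qed
qed

lemma bounded_partition_le_first: "1 \<le> i \<Longrightarrow> lam i \<le> lam 1"
proof (induction i rule: nat_induct)
  case 0 then show ?case by simp
next
  case (Suc n)
  show ?case
  proof (cases n)
    case 0 then show ?thesis by simp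
  next
    case (Suc n') then show ?thesis
      using Suc.IH sh[unfolded bounded_partition_def] \<open>n = Suc n'\<close>
      by (metis One_nat_def Suc_le_mono le0 le_trans)
  qed
qed

lemma subshape_row_eq: "{c. 1 \<le> c \<and> 0 < T i c \<and> T i c \<le> j} = {1..subshape T j i}"
proof -
  let ?S = "{c. 1 \<le> c \<and> 0 < T i c \<and> T i c \<le> j}"
  have "?S \<subseteq> {1..lam i}" using ssyt_nonzero_iff by auto
  then have fin: "finite ?S" using finite_subset by blast
  have "?S = {1..card ?S}"
  proof (rule eq_atLeastAtMost_card[OF fin])
    fix c c' assume c': "c' \<in> ?S" and c: "1 \<le> c" "c \<le> c'"
    have "T i c' \<noteq> 0" using c' by simp
    then have h: "1 \<le> i" "c' \<le> lam i" using ssyt_nonzero_iff[of i c'] by blast+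
    have "T i c \<noteq> 0" using ssyt_nonzero_iff[of i c] h c by linarith
    moreover have "T i c \<le> T i c'" by (rule ssyt_row_mono[OF c(1) c(2) h(2)])
    ultimately show "c \<in> ?S" using c c' by auto
  qed auto
  then show ?thesis by (simp add: subshape_def)
qed

lemma le_subshape_iff: "1 \<le> c \<Longrightarrow> c \<le> subshape T j i \<longleftrightarrow> 0 < T i c \<and> T i c \<le> j"
  using subshape_row_eq[of i j] by (metis (no_types, lifting) atLeastAtMost_iff mem_Collect_eq)

lemma subshape_0: "subshape T 0 = (\<lambda>i. 0)"
proof (rule ext)
  fix i have "{c. 1 \<le> c \<and> 0 < T i c \<and> T i c \<le> 0} = {}" by auto
  then show "subshape T 0 i = 0" unfolding subshape_def by (metis card.empty)
qed

lemma subshape_row0: "subshape T j 0 = 0"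
  using ssyt_zero_border by (simp add: subshape_def)

lemma subshape_le_shape: "subshape T j i \<le> lam i"
proof -
  have "c \<le> lam i" if "1 \<le> c" "c \<le> subshape T j i" for c
    using that le_subshape_iff[of c j i] ssyt_nonzero_iff[of i c] by linarith
  then show ?thesis by (cases "subshape T j i = 0") auto
qed

lemma subshape_full:
  assumes "\<And>i c. T i c \<le> k"
  shows "subshape T k i = lam i"
proof (cases "i = 0")
  case True then show ?thesis using sh subshape_row0 by (simp add: bounded_partition_def)
next
  case False
  show ?thesis
  proof (rule nat_eq_by_pos_le)
    fix c assume "1 \<le> (c::nat)"
    then show "c \<le> subshape T k i \<longleftrightarrow> c \<le> lam i"
      using le_subshape_iff assms ssyt_nonzero_iff False by auto
  qed
qed

lemma finite_entries_eq: "finite {(i, j). 1 \<le> i \<and> 1 \<le> j \<and> T i j = v \<and> v \<noteq> 0}"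
proof -
  have "{(i, j). 1 \<le> i \<and> 1 \<le> j \<and> T i j = v \<and> v \<noteq> 0}
      \<subseteq> {1..m} \<times> {1..lam 1}"
  proof
    fix p assume "p \<in> {(i, j). 1 \<le> i \<and> 1 \<le> j \<and> T i j = v \<and> v \<noteq> 0}"
    then obtain i j where h: "p = (i, j)" "1 \<le> i" "1 \<le> j" "T i j \<noteq> 0" by auto
    then have jl: "j \<le> lam i" using ssyt_nonzero_iff[of i j] by blast
    have "i \<le> m"
    proof (rule ccontr)
      assume "\<not> i \<le> m" then have "lam i = 0" using sh by (simp add: bounded_partition_def)
      then show False using jl h(3) by simp
    qed
    then show "p \<in> {1..m} \<times> {1..lam 1}" using bounded_partition_le_first[OF h(2)] jl h
      by simp
  qed
  then show ?thesis using finite_subset by blast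
qed

lemma ssyt_entries_le_length:
  assumes hc: "has_content T alpha"
  shows "T i c \<le> length alpha"
proof (rule ccontr)
  assume "\<not> T i c \<le> length alpha"
  then have v: "length alpha < T i c" "1 \<le> T i c" by auto
  have "T i c \<noteq> 0" using v by simp
  then have ic: "1 \<le> i" "1 \<le> c" using ssyt_nonzero_iff[of i c] by blast+
  let ?S = "{(i', j). 1 \<le> i' \<and> 1 \<le> j \<and> T i' j = T i c}"
  have "?S = {(i', j). 1 \<le> i' \<and> 1 \<le> j \<and> T i' j = T i c \<and> T i c \<noteq> 0}"
    using v by auto
  then have fin: "finite ?S" using finite_entries_eq by simp
  have mem: "(i, c) \<in> ?S" using ic by simp
  have "card ?S \<noteq> 0" using card_0_eq[OF fin] mem by blast
  moreover have "card ?S = (if T i c \<le> length alpha then alpha ! (T i c - 1) else 0)"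
    using hc[unfolded has_content_def, rule_format, OF v(2)] by simp
  then have "card ?S = 0" using v(1) by simp
  ultimately show False by simp
qed

end

definition tab_restrict :: "(nat \<Rightarrow> nat \<Rightarrow> nat) \<Rightarrow> nat \<Rightarrow> nat \<Rightarrow> nat \<Rightarrow> nat" where
  "tab_restrict T k i c = (if T i c \<le> k then T i c else 0)"

definition wt_factor :: "real \<Rightarrow> (nat \<Rightarrow> nat \<Rightarrow> nat) \<Rightarrow> nat \<times> nat \<Rightarrow> real" where
  "wt_factor q T = (\<lambda>(i,j). if 1 \<le> i \<and> 1 \<le> j then
       qbinom q (subshape T j i - subshape T j (i+1)) (subshape T j i - subshape T (j-1) i)
     else 1)"

lemma wt_q_eq_Prod_any: "wt_q q T = Prod_any (wt_factor q T)"
  by (simp add: wt_q_def wt_factor_def)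

lemma subshape_tab_restrict:
  "j \<le> k \<Longrightarrow> subshape (tab_restrict T k) j = subshape T j"
proof (rule ext)
  fix i assume "j \<le> k"
  then have "{c. 1 \<le> c \<and> 0 < tab_restrict T k i c \<and> tab_restrict T k i c \<le> j}
      = {c. 1 \<le> c \<and> 0 < T i c \<and> T i c \<le> j}"
    by (auto simp: tab_restrict_def)
  then show "subshape (tab_restrict T k) j i = subshape T j i" by (simp add: subshape_def)
qed

lemma wt_factor_eq_1:
  "subshape T j i = subshape T (j - 1) i \<Longrightarrow> 0 < q \<Longrightarrow> wt_factor q T (i, j) = 1"
  by (simp add: wt_factor_def qbinom_0)

lemma wt_factor_support:
  assumes ss: "ssyt lam T" and sh: "bounded_partition lam m" and le: "\<And>i c. T i c \<le> k"
    and q: "0 < q"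
  shows "{p. wt_factor q T p \<noteq> 1} \<subseteq> {1..m} \<times> {1..k}"
proof
  fix p assume p: "p \<in> {p. wt_factor q T p \<noteq> 1}"
  obtain i j where ij: "p = (i, j)" by (cases p)
  have ij1: "1 \<le> i" "1 \<le> j" using p ij by (auto simp: wt_factor_def split: if_splits)
  have "i \<le> m"
  proof (rule ccontr)
    assume "\<not> i \<le> m"
    then have "lam i = 0" "lam (Suc i) = 0" using sh by (auto simp: bounded_partition_def)
    then have "subshape T j i = 0" "subshape T j (i+1) = 0" "subshape T (j-1) i = 0"
      using subshape_le_shape[OF ss sh, of j i] subshape_le_shape[OF ss sh, of j "Suc i"]
        subshape_le_shape[OF ss sh, of "j-1" i] by simp_all
    then have "wt_factor q T (i, j) = 1" using q by (intro wt_factor_eq_1) simp_all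
    then show False using p ij by simp
  qed
  moreover have "j \<le> k"
  proof (rule ccontr)
    assume "\<not> j \<le> k"
    then have kj: "k \<le> j - 1" by simp
    have "T i c \<le> j" "T i c \<le> j - 1" for i c using le[of i c] kj by linarith+
    then have "subshape T j = lam" "subshape T (j - 1) = lam"
      using subshape_full[OF ss sh] by (auto intro!: ext)
    then have "wt_factor q T (i, j) = 1" using q by (intro wt_factor_eq_1) simp_all
    then show False using p ij by simp
  qed
  ultimately show "p \<in> {1..m} \<times> {1..k}" using ij ij1 by simp
qed

lemma wt_q_eq_prod:
  assumes ss: "ssyt lam T" and sh: "bounded_partition lam m" and le: "\<And>i c. T i c \<le> k"
    and q: "0 < q"
  shows "wt_q q T = (\<Prod>i\<in>{1..m}. \<Prod>j\<in>{1..k}. wt_factor q T (i, j))"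
proof -
  have "Prod_any (wt_factor q T) = prod (wt_factor q T) ({1..m} \<times> {1..k})"
    by (rule Prod_any.expand_superset[OF _ wt_factor_support[OF assms]]) simp
  then show ?thesis by (simp add: wt_q_eq_Prod_any prod.cartesian_product)
qed

context
  fixes lam :: "nat \<Rightarrow> nat" and T :: "nat \<Rightarrow> nat \<Rightarrow> nat"
    and m k :: nat and alpha :: "nat list"
  assumes ss: "ssyt lam T" and sh: "bounded_partition lam m" and hc: "has_content T alpha"
    and len: "length alpha = Suc k"
begin

abbreviation "inner_shape \<equiv> subshape T k"

lemma ssyt_entries_le_Suc: "T i c \<le> Suc k" using ssyt_entries_le_length[OF ss sh hc] len by simp

lemma tab_restrict_nonzero_iff:
  "tab_restrict T k i c \<noteq> 0 \<longleftrightarrow> in_shape inner_shape i c"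
proof (cases "1 \<le> i \<and> 1 \<le> c")
  case True
  then show ?thesis using le_subshape_iff[OF ss sh, of c k i]
    by (auto simp: tab_restrict_def in_shape_def)
next
  case False
  then have "T i c = 0" using ssyt_nonzero_iff[OF ss sh, of i c] by auto
  then show ?thesis using False by (auto simp: tab_restrict_def in_shape_def)
qed

lemma inner_shape_le: "inner_shape i \<le> lam i" by (rule subshape_le_shape[OF ss sh])

lemma tab_restrict_eq:
  "1 \<le> c \<Longrightarrow> c \<le> inner_shape i \<Longrightarrow> tab_restrict T k i c = T i c"
  using le_subshape_iff[OF ss sh, of c k i] by (simp add: tab_restrict_def)

lemma ssyt_tab_restrict: "ssyt inner_shape (tab_restrict T k)"
  unfolding ssyt_def
proof (intro conjI allI impI)
  fix i c show "in_shape inner_shape i c \<longleftrightarrow> tab_restrict T k i c \<noteq> 0"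
    using tab_restrict_nonzero_iff by simp
next
  fix i c assume a: "in_shape inner_shape i (c + 1)"
  then have c1: "1 \<le> i" "c + 1 \<le> inner_shape i" by (auto simp: in_shape_def)
  show "tab_restrict T k i c \<le> tab_restrict T k i (c + 1)"
  proof (cases "c = 0")
    case True then show ?thesis by (simp add: tab_restrict_def ssyt_zero_border[OF ss sh])
  next
    case False
    then have "tab_restrict T k i c = T i c" "tab_restrict T k i (c+1) = T i (c+1)"
      using tab_restrict_eq c1 by auto
    moreover have "T i c \<le> T i (Suc c)"
      using ssyt_row_step[OF ss sh, of i c] c1 False inner_shape_le[of i] by simp
    ultimately show ?thesis by simp
  qed
next
  fix i c assume a: "in_shape inner_shape (i + 1) c"
  then have c1: "1 \<le> c" "c \<le> inner_shape (Suc i)" by (auto simp: in_shape_def)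
  have r1: "tab_restrict T k (Suc i) c = T (Suc i) c" using tab_restrict_eq c1 by simp
  have "0 < T (Suc i) c \<and> T (Suc i) c \<le> k"
    using le_subshape_iff[OF ss sh, of c k "Suc i"] c1 by simp
  moreover have "T i c < T (Suc i) c"
    using ssyt_col_step[OF ss sh, of c i] c1 inner_shape_le[of "Suc i"] by simp
  ultimately show "tab_restrict T k i c < tab_restrict T k (i + 1) c" using r1
    by (simp add: tab_restrict_def)
qed

lemma bounded_inner_shape: "bounded_partition inner_shape m"
  unfolding bounded_partition_def
proof (intro conjI allI impI)
  show "inner_shape 0 = 0" by (rule subshape_row0[OF ss sh])
next
  fix i :: nat assume "m < i" then show "inner_shape i = 0" using inner_shape_le[of i] sh
    by (simp add: bounded_partition_def)
next
  fix i
  have "c \<le> inner_shape (Suc i)" if c: "1 \<le> c" "c \<le> inner_shape (Suc (Suc i))" for c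
  proof -
    have t2: "0 < T (Suc (Suc i)) c" "T (Suc (Suc i)) c \<le> k"
      using le_subshape_iff[OF ss sh, of c k] c by auto
    have "c \<le> lam (Suc (Suc i))" using inner_shape_le c(2) le_trans by blast
    then have cl: "c \<le> lam (Suc i)" using sh by (metis bounded_partition_def le_trans)
    have "T (Suc i) c < T (Suc (Suc i)) c"
      using ssyt_col_step[OF ss sh, of c "Suc i"] c \<open>c \<le> lam (Suc (Suc i))\<close> by simp
    moreover have "T (Suc i) c \<noteq> 0" using ssyt_nonzero_iff[OF ss sh, of "Suc i" c] c cl
      by simp
    ultimately show ?thesis using le_subshape_iff[OF ss sh, of c k "Suc i"] c t2 by simp
  qed
  then show "inner_shape (Suc (Suc i)) \<le> inner_shape (Suc i)"
    by (cases "inner_shape (Suc (Suc i)) = 0") auto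
qed

lemma shape_Suc_le_inner_shape: "lam (Suc (Suc i)) \<le> inner_shape (Suc i)"
proof -
  have "c \<le> inner_shape (Suc i)" if c: "1 \<le> c" "c \<le> lam (Suc (Suc i))" for c
  proof -
    have cl: "c \<le> lam (Suc i)" using sh c by (metis bounded_partition_def le_trans)
    have "T (Suc i) c < T (Suc (Suc i)) c" using ssyt_col_step[OF ss sh, of c "Suc i"] c by simp
    moreover have "T (Suc (Suc i)) c \<le> Suc k" by (rule ssyt_entries_le_Suc)
    moreover have "T (Suc i) c \<noteq> 0" using ssyt_nonzero_iff[OF ss sh, of "Suc i" c] c cl
      by simp
    ultimately show ?thesis using le_subshape_iff[OF ss sh, of c k "Suc i"] c by simp
  qed
  then show ?thesis by (cases "lam (Suc (Suc i)) = 0") auto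
qed

lemma has_content_tab_restrict: "has_content (tab_restrict T k) (butlast alpha)"
  unfolding has_content_def
proof (intro allI impI)
  fix v :: nat assume v: "1 \<le> v"
  show "card {(i, j). 1 \<le> i \<and> 1 \<le> j \<and> tab_restrict T k i j = v} =
        (if v \<le> length (butlast alpha) then butlast alpha ! (v - 1) else 0)"
  proof (cases "v \<le> k")
    case True
    then have "{(i, j). 1 \<le> i \<and> 1 \<le> j \<and> tab_restrict T k i j = v}
        = {(i, j). 1 \<le> i \<and> 1 \<le> j \<and> T i j = v}"
      using v by (auto simp: tab_restrict_def)
    moreover have "butlast alpha ! (v - 1) = alpha ! (v - 1)" using True v len
      by (simp add: nth_butlast)
    ultimately show ?thesis using hc[unfolded has_content_def, rule_format, OF v] True len by simp
  next
    case False
    then have "{(i, j). 1 \<le> i \<and> 1 \<le> j \<and> tab_restrict T k i j = v} = {}"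
      using v by (auto simp: tab_restrict_def)
    then have "card {(i, j). 1 \<le> i \<and> 1 \<le> j \<and> tab_restrict T k i j = v} = 0"
      by (metis card.empty)
    then show ?thesis using False len by simp
  qed
qed

lemma tab_restrict_le: "tab_restrict T k i c \<le> k" by (simp add: tab_restrict_def)

lemma wt_q_tab_restrict:
  assumes q: "0 < q"
  shows "wt_q q T = wt_q q (tab_restrict T k) *
    (\<Prod>i\<in>{1..m}. qbinom q (lam i - lam (i+1)) (lam i - inner_shape i))"
proof -
  have row: "(\<Prod>j\<in>{1..Suc k}. wt_factor q T (i, j)) =
      (\<Prod>j\<in>{1..k}. wt_factor q (tab_restrict T k) (i, j)) *
      qbinom q (lam i - lam (i+1)) (lam i - inner_shape i)" if "1 \<le> i" for i
  proof -
    have "wt_factor q T (i, j) = wt_factor q (tab_restrict T k) (i, j)" if "j \<in> {1..k}" for j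
    proof -
      have "subshape (tab_restrict T k) j = subshape T j"
        "subshape (tab_restrict T k) (j - 1) = subshape T (j - 1)"
        using that by (auto intro: subshape_tab_restrict)
      then show ?thesis by (simp add: wt_factor_def)
    qed
    moreover have "subshape T (Suc k) = lam"
      using subshape_full[OF ss sh ssyt_entries_le_Suc] by (intro ext) simp
    ultimately show ?thesis using that by (simp add: prod.cl_ivl_Suc wt_factor_def)
  qed
  have "(\<Prod>i\<in>{1..m}. \<Prod>j\<in>{1..Suc k}. wt_factor q T (i, j)) =
      (\<Prod>i\<in>{1..m}. (\<Prod>j\<in>{1..k}. wt_factor q (tab_restrict T k) (i, j)) *
        qbinom q (lam i - lam (i+1)) (lam i - inner_shape i))"
    by (intro prod.cong refl row) simp
  then show ?thesis
    unfolding wt_q_eq_prod[OF ss sh ssyt_entries_le_Suc q]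
      wt_q_eq_prod[OF ssyt_tab_restrict bounded_inner_shape tab_restrict_le q]
    by (simp add: prod.distrib)
qed

end

definition tab_extend ::
  "(nat \<Rightarrow> nat \<Rightarrow> nat) \<Rightarrow> (nat \<Rightarrow> nat) \<Rightarrow> (nat \<Rightarrow> nat) \<Rightarrow> nat \<Rightarrow> nat \<Rightarrow> nat \<Rightarrow> nat" where
  "tab_extend T' mu lam k i c
      = (if c \<le> mu i then T' i c else if c \<le> lam i then Suc k else 0)"

lemma card_skew_shape:
  fixes mu lam :: "nat \<Rightarrow> nat" and m :: nat
  assumes le: "\<And>i. mu i \<le> lam i" and van: "\<And>i. m < i \<Longrightarrow> lam i = 0"
  shows "card {(i, c). 1 \<le> i \<and> 1 \<le> c \<and> mu i < c \<and> c \<le> lam i}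
      = (\<Sum>i\<in>{1..m}. lam i - mu i)"
proof -
  have "{(i, c). 1 \<le> i \<and> 1 \<le> c \<and> mu i < c \<and> c \<le> lam i}
      = (\<Union>i\<in>{1..m}. {i} \<times> {Suc (mu i)..lam i})"
  proof (rule set_eqI)
    fix p :: "nat \<times> nat"
    obtain i c where p: "p = (i, c)" by (cases p)
    have "i \<le> m" if "1 \<le> c" "c \<le> lam i"
    proof (rule ccontr)
      assume "\<not> i \<le> m" then have "lam i = 0" using van by simp
      then show False using that by simp
    qed
    then show "p \<in> {(i, c). 1 \<le> i \<and> 1 \<le> c \<and> mu i < c \<and> c \<le> lam i} \<longleftrightarrow>
               p \<in> (\<Union>i\<in>{1..m}. {i} \<times> {Suc (mu i)..lam i})"
      using p by auto
  qed
  moreover have "card (\<Union>i\<in>{1..m}. {i} \<times> {Suc (mu i)..lam i})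
      = (\<Sum>i\<in>{1..m}. card ({i} \<times> {Suc (mu i)..lam i}))"
    by (rule card_UN_disjoint) auto
  ultimately show ?thesis by (simp add: card_cartesian_product)
qed

context
  fixes lam mu :: "nat \<Rightarrow> nat" and T' :: "nat \<Rightarrow> nat \<Rightarrow> nat"
    and m k :: nat and alpha' :: "nat list"
  assumes ss': "ssyt mu T'" and shm: "bounded_partition mu m" and hc': "has_content T' alpha'"
    and len': "length alpha' = k" and shl: "bounded_partition lam m"
    and i1: "\<And>i. mu (Suc i) \<le> lam (Suc i)" and i2: "\<And>i. lam (Suc (Suc i)) \<le> mu (Suc i)"
begin

abbreviation "ext_tab \<equiv> tab_extend T' mu lam k"

lemma tab_extend_base_le: "T' i c \<le> k" using ssyt_entries_le_length[OF ss' shm hc'] len' by simp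

lemma inner_le_outer: "mu i \<le> lam i"
  using i1 shm by (cases i) (auto simp: bounded_partition_def)

lemma tab_extend_base_nonzero_iff: "T' i c \<noteq> 0 \<longleftrightarrow> 1 \<le> i \<and> 1 \<le> c \<and> c \<le> mu i"
  by (rule ssyt_nonzero_iff[OF ss' shm])

lemma tab_extend_nonzero_iff: "in_shape lam i c \<longleftrightarrow> ext_tab i c \<noteq> 0"
proof (cases "c \<le> mu i")
  case True
  then show ?thesis using tab_extend_base_nonzero_iff[of i c] inner_le_outer[of i]
    by (auto simp: tab_extend_def in_shape_def)
next
  case False
  then have "1 \<le> c" by simp
  moreover have "c \<le> lam i \<Longrightarrow> 1 \<le> i" using False shl
    by (cases i) (auto simp: bounded_partition_def)
  ultimately show ?thesis using False by (auto simp: tab_extend_def in_shape_def)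
qed

lemma ssyt_tab_extend: "ssyt lam ext_tab"
  unfolding ssyt_def
proof (intro conjI allI impI)
  fix i c
  show "in_shape lam i c \<longleftrightarrow> ext_tab i c \<noteq> 0"
    by (rule tab_extend_nonzero_iff)
next
  fix i c assume a: "in_shape lam i (c + 1)"
  show "ext_tab i c \<le> ext_tab i (c + 1)"
  proof (cases "c + 1 \<le> mu i")
    case True
    then show ?thesis using ss' unfolding ssyt_def in_shape_def
      using a by (auto simp: tab_extend_def in_shape_def)
  next
    case False
    then show ?thesis using a tab_extend_base_le[of i c] by (auto simp: tab_extend_def in_shape_def)
  qed
next
  fix i c assume a: "in_shape lam (i + 1) c"
  show "ext_tab i c < ext_tab (i + 1) c"
  proof (cases i)
    case 0
    then have "ext_tab i c = 0" using shl tab_extend_base_nonzero_iff[of 0 c]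
      by (auto simp: tab_extend_def bounded_partition_def)
    moreover have "ext_tab (i + 1) c \<noteq> 0" using tab_extend_nonzero_iff a by blast
    ultimately show ?thesis by simp
  next
    case (Suc i')
    have c: "1 \<le> c" "c \<le> lam (Suc (Suc i'))" using a Suc by (auto simp: in_shape_def)
    then have cm: "c \<le> mu (Suc i')" using i2[of i'] by simp
    then have t1: "ext_tab i c = T' i c" using Suc by (simp add: tab_extend_def)
    show ?thesis
    proof (cases "c \<le> mu (Suc i)")
      case True
      then show ?thesis using t1 ss' c unfolding ssyt_def in_shape_def
        by (auto simp: tab_extend_def)
    next
      case False
      then show ?thesis using t1 tab_extend_base_le[of i c] c Suc by (auto simp: tab_extend_def)
    qed
  qed
qed

lemma tab_restrict_tab_extend: "tab_restrict ext_tab k = T'"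
proof (intro ext)
  fix i c show "tab_restrict ext_tab k i c = T' i c"
  proof (cases "c \<le> mu i")
    case True then show ?thesis using tab_extend_base_le[of i c]
      by (simp add: tab_restrict_def tab_extend_def)
  next
    case False
    then have "T' i c = 0" using tab_extend_base_nonzero_iff[of i c] by auto
    then show ?thesis using False by (simp add: tab_restrict_def tab_extend_def)
  qed
qed

lemma tab_extend_le: "ext_tab i c \<le> Suc k" using tab_extend_base_le[of i c]
  by (simp add: tab_extend_def)

lemma subshape_tab_extend_top: "subshape ext_tab (Suc k) = lam"
  by (intro ext subshape_full[OF ssyt_tab_extend shl tab_extend_le])

lemma tab_extend_level_le:
  assumes "1 \<le> v" "v \<le> k"
  shows "{(i, j). 1 \<le> i \<and> 1 \<le> j \<and> ext_tab i j = v}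
      = {(i, j). 1 \<le> i \<and> 1 \<le> j \<and> T' i j = v}"
proof -
  have "ext_tab i j = v \<longleftrightarrow> T' i j = v" for i j
    using tab_extend_base_nonzero_iff[of i j] assms by (auto simp: tab_extend_def)
  then show ?thesis by simp
qed

lemma tab_extend_level_top:
  "{(i, j). 1 \<le> i \<and> 1 \<le> j \<and> ext_tab i j = Suc k} =
    {(i, j). 1 \<le> i \<and> 1 \<le> j \<and> mu i < j \<and> j \<le> lam i}"
proof -
  have "ext_tab i j = Suc k \<longleftrightarrow> mu i < j \<and> j \<le> lam i" for i j
    using tab_extend_base_le[of i j] by (auto simp: tab_extend_def)
  then show ?thesis by simp
qed

lemma has_content_tab_extend:
  assumes a: "a = (\<Sum>i\<in>{1..m}. lam i - mu i)"
  shows "has_content ext_tab (alpha' @ [a])"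
  unfolding has_content_def
proof (intro allI impI)
  fix v :: nat assume v: "1 \<le> v"
  consider "v \<le> k" | "v = Suc k" | "Suc k < v" by linarith
  then show "card {(i, j). 1 \<le> i \<and> 1 \<le> j \<and> ext_tab i j = v} =
      (if v \<le> length (alpha' @ [a]) then (alpha' @ [a]) ! (v - 1) else 0)"
  proof cases
    case 1
    then have "v - 1 < length alpha'" using v len' by linarith
    then have "(alpha' @ [a]) ! (v - 1) = alpha' ! (v - 1)" by (simp add: nth_append)
    then show ?thesis
      using 1 tab_extend_level_le[OF v] hc'[unfolded has_content_def, rule_format, OF v] len'
        by simp
  next
    case 2
    have "card {(i, j). 1 \<le> i \<and> 1 \<le> j \<and> mu i < j \<and> j \<le> lam i} = a"
      unfolding a using inner_le_outer shl
        by (intro card_skew_shape) (auto simp: bounded_partition_def)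
    moreover have "(alpha' @ [a]) ! k = a" using len' by (metis nth_append_length)
    ultimately show ?thesis using 2 tab_extend_level_top len' by simp
  next
    case 3
    then have "{(i, j). 1 \<le> i \<and> 1 \<le> j \<and> ext_tab i j = v} = {}"
      using tab_extend_le by (auto simp: not_le[symmetric])
    then have "card {(i, j). 1 \<le> i \<and> 1 \<le> j \<and> ext_tab i j = v} = 0"
      by (metis card.empty)
    then show ?thesis using 3 len' by simp
  qed
qed

end

lemma ssyt_eq_if_subshapes_eq:
  assumes s1: "ssyt lam T1" and s2: "ssyt lam T2" and sh: "bounded_partition lam m"
    and l1: "\<And>i c. T1 i c \<le> k" and l2: "\<And>i c. T2 i c \<le> k"
    and eq: "\<And>j. j \<le> k \<Longrightarrow> subshape T1 j = subshape T2 j"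
  shows "T1 = T2"
proof (intro ext)
  fix i c
  show "T1 i c = T2 i c"
  proof (cases "1 \<le> c")
    case False
    then have "c = 0" by simp
    then show ?thesis using ssyt_zero_border[OF s1 sh] ssyt_zero_border[OF s2 sh] by simp
  next
    case c: True
    have key: "0 < T1 i c \<and> T1 i c \<le> j \<longleftrightarrow> 0 < T2 i c \<and> T2 i c \<le> j" if "j \<le> k" for j
      using le_subshape_iff[OF s1 sh c, of j i] le_subshape_iff[OF s2 sh c, of j i] eq[OF that]
      by simp
    show ?thesis
      using key[OF l1[of i c]] key[OF l2[of i c]] key[OF order_refl] l1[of i c] l2[of i c] by auto
  qed
qed

lemma finite_ssyt:
  assumes sh: "bounded_partition lam m"
  shows "finite {T. ssyt_content lam alpha T}"
proof -
  let ?R = "{1..m} \<times> {1..lam 1}"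
  let ?k = "length alpha"
  let ?F = "{f :: nat \<times> nat \<Rightarrow> nat. \<forall>x. (x \<in> ?R \<longrightarrow> f x \<in> {0..?k}) \<and> (x \<notin> ?R \<longrightarrow> f x = 0)}"
  have fin: "finite ?F" by (rule finite_set_of_finite_funs) auto
  have "{T. ssyt_content lam alpha T} \<subseteq> curry ` ?F"
  proof
    fix T assume "T \<in> {T. ssyt_content lam alpha T}"
    then have ss: "ssyt lam T" and hc: "has_content T alpha" by (auto simp: ssyt_content_def)
    have "case_prod T \<in> ?F"
    proof (intro CollectI allI conjI impI)
      fix x :: "nat \<times> nat"
      obtain i c where x: "x = (i, c)" by (cases x)
      show "case_prod T x \<in> {0..?k}" using ssyt_entries_le_length[OF ss sh hc, of i c] x by simp
      assume "x \<notin> ?R"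
      show "case_prod T x = 0"
      proof (rule ccontr)
        assume "case_prod T x \<noteq> 0"
        then have "T i c \<noteq> 0" using x by simp
        then have h: "1 \<le> i" "1 \<le> c" "c \<le> lam i"
          using ssyt_nonzero_iff[OF ss sh, of i c] by blast+
        have "i \<le> m"
        proof (rule ccontr)
          assume "\<not> i \<le> m" then have "lam i = 0" using sh
            by (simp add: bounded_partition_def)
          then show False using h by simp
        qed
        then show False
          using \<open>x \<notin> ?R\<close> x h bounded_partition_le_first[OF ss sh h(1)] by simp
      qed
    qed
    moreover have "T = curry (case_prod T)" by simp
    ultimately show "T \<in> curry ` ?F" by blast
  qed
  then show ?thesis using finite_subset fin by blast
qed

lemma psum_shape_eq_sum_list:
  assumes ss: "ssyt lam T" and sh: "bounded_partition lam m" and hc: "has_content T alpha"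
  shows "psum lam m = sum_list alpha"
proof -
  let ?S = "{(i, c). 1 \<le> i \<and> 1 \<le> c \<and> T i c \<noteq> 0}"
  have "?S = {(i, c). 1 \<le> i \<and> 1 \<le> c \<and> (\<lambda>_. 0::nat) i < c \<and> c \<le> lam i}"
    using ssyt_nonzero_iff[OF ss sh] by auto
  then have c1: "card ?S = (\<Sum>i\<in>{1..m}. lam i - 0)"
    using card_skew_shape[of "\<lambda>_. 0" lam m] sh by (simp add: bounded_partition_def)
  have "?S = (\<Union>v\<in>{1..length alpha}. {(i, c). 1 \<le> i \<and> 1 \<le> c \<and> T i c = v})"
    using ssyt_entries_le_length[OF ss sh hc] by (auto simp: Suc_le_eq)
  moreover have "card (\<Union>v\<in>{1..length alpha}. {(i, c). 1 \<le> i \<and> 1 \<le> c \<and> T i c = v})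
      = (\<Sum>v\<in>{1..length alpha}. card {(i, c). 1 \<le> i \<and> 1 \<le> c \<and> T i c = v})"
  proof (rule card_UN_disjoint)
    show "\<forall>v\<in>{1..length alpha}. finite {(i, c). 1 \<le> i \<and> 1 \<le> c \<and> T i c = v}"
    proof
      fix v assume "v \<in> {1..length alpha}"
      then have "{(i, c). 1 \<le> i \<and> 1 \<le> c \<and> T i c = v}
          = {(i, c). 1 \<le> i \<and> 1 \<le> c \<and> T i c = v \<and> v \<noteq> 0}"
        by auto
      then show "finite {(i, c). 1 \<le> i \<and> 1 \<le> c \<and> T i c = v}"
        using finite_entries_eq[OF ss sh, of v] by simp
    qed
  qed auto
  moreover have "(\<Sum>v\<in>{1..length alpha}. card {(i, c). 1 \<le> i \<and> 1 \<le> c \<and> T i c = v}) =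
      (\<Sum>v\<in>{1..length alpha}. alpha ! (v - 1))"
    using hc unfolding has_content_def by (intro sum.cong) auto
  moreover have "(\<Sum>v\<in>{1..length alpha}. alpha ! (v - 1)) = sum_list alpha"
    by (simp add: sum_list_sum_nth sum.atLeast1_atMost_eq atLeast0LessThan)
  ultimately have "card ?S = sum_list alpha" by simp
  then show ?thesis using c1 by (simp add: psum_def)
qed

definition flags_of :: "('k::field^'n) set \<Rightarrow> nat list \<Rightarrow> (('k^'n) set) list set" where
  "flags_of U alpha = {F. length F = length alpha + 1
     \<and> (\<forall>i\<le>length alpha. vec.subspace (F ! i) \<and> vec.dim (F ! i) = sum_list (take i alpha))
     \<and> (\<forall>i<length alpha. F ! i \<subseteq> F ! (i+1))
     \<and> F ! 0 = {0} \<and> F ! length alpha = U}"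

lemma Fl_eq_flags_of: "Fl alpha = flags_of UNIV alpha" by (simp add: Fl_def flags_of_def)

definition compatible_flags_of_type :: "'k::field^'n^'n \<Rightarrow> ('k^'n) set \<Rightarrow> nat list \<Rightarrow>
    (nat \<Rightarrow> nat \<Rightarrow> nat) \<Rightarrow> (('k^'n) set) list set" where
  "compatible_flags_of_type N U alpha T
      = {F \<in> flags_of U alpha. strictly_compatible N F \<and> JF_flag_is N F T}"

definition compatible_flags ::
  "'k::field^'n^'n \<Rightarrow> ('k^'n) set \<Rightarrow> nat list \<Rightarrow> (('k^'n) set) list set" where
  "compatible_flags N U alpha = {F \<in> flags_of U alpha. strictly_compatible N F}"

lemma finite_flags_of: "finite (flags_of (U::('k::{field,finite}^'n) set) alpha)"
proof -
  have "flags_of U alpha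
      \<subseteq> {xs. set xs \<subseteq> UNIV \<and> length xs = length alpha + 1}" by (auto simp: flags_of_def)
  then show ?thesis using finite_lists_length_eq[of "UNIV :: ('k^'n) set set"] finite_subset by auto
qed

lemma flag_butlast:
  assumes F: "F \<in> flags_of U (alpha @ [a])" and sc: "strictly_compatible N F"
  defines "k \<equiv> length alpha"
  shows "F = butlast F @ [U]" "butlast F \<in> flags_of (F ! k) alpha"
    "strictly_compatible N (butlast F)"
    "(*v) N ` U \<subseteq> F ! k" "F ! k \<subseteq> U"
proof -
  have len: "length F = Suc (Suc k)" using F by (simp add: flags_of_def k_def)
  have last: "F ! Suc k = U" using F by (simp add: flags_of_def k_def)
  have nb: "butlast F ! i = F ! i" if "i \<le> k" for i using that len by (simp add: nth_butlast)
  show "F = butlast F @ [U]"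
  proof -
    have "F \<noteq> []" using len by auto
    moreover have "last F = U" using last len by (subst last_conv_nth) auto
    ultimately show ?thesis by (metis append_butlast_last_id)
  qed
  show "butlast F \<in> flags_of (F ! k) alpha"
    using F len nb unfolding flags_of_def k_def[symmetric]
    by (auto simp: k_def)
  show "strictly_compatible N (butlast F)"
    unfolding strictly_compatible_def
  proof (intro allI impI)
    fix i assume i: "1 \<le> i \<and> i < length (butlast F)"
    then have "i \<le> k" "i - 1 \<le> k" "i < length F" using len by auto
    then show "(*v) N ` (butlast F ! i) \<subseteq> butlast F ! (i - 1)"
      using sc i nb unfolding strictly_compatible_def by simp
  qed
  show "(*v) N ` U \<subseteq> F ! k"
  proof -
    have "(*v) N ` (F ! Suc k) \<subseteq> F ! (Suc k - 1)"
      using sc len unfolding strictly_compatible_def by (metis le_add1 lessI plus_1_eq_Suc)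
    then show ?thesis using last by simp
  qed
  show "F ! k \<subseteq> U"
    using F last unfolding flags_of_def k_def by auto
qed

lemma snoc_mem_flags_of:
  assumes F': "F' \<in> flags_of W alpha" and WU: "W \<subseteq> U"
    and sU: "vec.subspace U" and dU: "vec.dim U = sum_list (alpha @ [a])"
  shows "F' @ [U] \<in> flags_of U (alpha @ [a])"
proof -
  let ?k = "length alpha"
  have len: "length F' = Suc ?k" using F' by (simp add: flags_of_def)
  have nth1: "(F' @ [U]) ! i = F' ! i" if "i \<le> ?k" for i using that len
    by (simp add: nth_append)
  have nth2: "(F' @ [U]) ! Suc ?k = U" using len by (simp add: nth_append)
  have Wk: "F' ! ?k = W" using F' by (simp add: flags_of_def)
  show ?thesis
    unfolding flags_of_def
  proof (intro CollectI conjI allI impI)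
    show "length (F' @ [U]) = length (alpha @ [a]) + 1" using len by simp
  next
    fix i assume i: "i \<le> length (alpha @ [a])"
    show "vec.subspace ((F' @ [U]) ! i)"
    proof (cases "i \<le> ?k")
      case True then show ?thesis using F' nth1 by (simp add: flags_of_def)
    next
      case False then have "i = Suc ?k" using i by simp
      then show ?thesis using nth2 sU dU by simp
    qed
  next
    fix i assume i: "i \<le> length (alpha @ [a])"
    show "vec.dim ((F' @ [U]) ! i) = sum_list (take i (alpha @ [a]))"
    proof (cases "i \<le> ?k")
      case True then show ?thesis using F' nth1 by (simp add: flags_of_def)
    next
      case False then have "i = Suc ?k" using i by simp
      then show ?thesis using nth2 sU dU by simp
    qed
  next
    fix i assume i: "i < length (alpha @ [a])"
    show "(F' @ [U]) ! i \<subseteq> (F' @ [U]) ! (i + 1)"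
    proof (cases "i < ?k")
      case True then show ?thesis using F' nth1[of i] nth1[of "Suc i"] by (simp add: flags_of_def)
    next
      case False then have "i = ?k" using i by simp
      then show ?thesis using nth1[of ?k] nth2 Wk WU by simp
    qed
  next
    show "(F' @ [U]) ! 0 = {0}" using F' nth1[of 0] by (simp add: flags_of_def)
    show "(F' @ [U]) ! length (alpha @ [a]) = U" using nth2 by simp
  qed
qed

lemma strictly_compatible_snoc:
  assumes F': "F' \<in> flags_of W alpha" and sc: "strictly_compatible N F'"
    and NU: "(*v) N ` U \<subseteq> W"
  shows "strictly_compatible N (F' @ [U])"
  unfolding strictly_compatible_def
proof (intro allI impI)
  let ?k = "length alpha"
  have len: "length F' = Suc ?k" and Wk: "F' ! ?k = W" using F' by (simp_all add: flags_of_def)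
  have nth1: "(F' @ [U]) ! i = F' ! i" if "i \<le> ?k" for i using that len
    by (simp add: nth_append)
  fix i assume i: "1 \<le> i \<and> i < length (F' @ [U])"
  show "(*v) N ` ((F' @ [U]) ! i) \<subseteq> (F' @ [U]) ! (i - 1)"
  proof (cases "i \<le> ?k")
    case True then show ?thesis using sc i nth1[of i] nth1[of "i - 1"] len
      unfolding strictly_compatible_def by auto
  next
    case False then have "i = Suc ?k" using i len by simp
    then show ?thesis using nth1[of ?k] len Wk NU by (simp add: nth_append)
  qed
qed

lemma JF_flag_is_snoc:
  "JF_flag_is N (F' @ [U]) T \<longleftrightarrow> JF_flag_is N F' T \<and> subshape T (length F')
      = JF_on U N"
  unfolding JF_flag_is_def by (auto simp: nth_append less_Suc_eq)

lemma JF_flag_is_tab_restrict: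
  assumes "length F' = Suc k"
  shows "JF_flag_is N F' (tab_restrict T k) \<longleftrightarrow> JF_flag_is N F' T"
  unfolding JF_flag_is_def using assms subshape_tab_restrict[of _ k T] by auto

lemma compatible_flags_of_type_snoc:
  fixes N :: "'k::{field,finite}^'n^'n"
  assumes sU: "vec.subspace U" and dU: "vec.dim U = sum_list (alpha @ [a])"
    and top: "subshape T (Suc (length alpha)) = JF_on U N"
  shows "compatible_flags_of_type N U (alpha @ [a]) T =
    (\<Union>W\<in>subspaces_of_type N U (subshape T (length alpha)).
      (\<lambda>F'. F' @ [U]) ` compatible_flags_of_type N W alpha (tab_restrict T (length alpha)))"
  (is "?L = ?R")
proof
  let ?k = "length alpha"
  show "?L \<subseteq> ?R"
  proof
    fix F assume "F \<in> ?L"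
    then have F: "F \<in> flags_of U (alpha @ [a])" "strictly_compatible N F" "JF_flag_is N F T"
      by (auto simp: compatible_flags_of_type_def)
    note d = flag_butlast[OF F(1,2)]
    let ?W = "F ! ?k"
    let ?F' = "butlast F"
    have lenF': "length ?F' = Suc ?k" using d(2) by (simp add: flags_of_def)
    have J: "JF_flag_is N ?F' T" using F(3) d(1) JF_flag_is_snoc[of N ?F' U T] by metis
    have sW: "vec.subspace ?W" using d(2) unfolding flags_of_def
      by (metis (mono_tags, lifting) mem_Collect_eq order_refl)
    have "subshape T ?k = JF_on (?F' ! ?k) N" using J lenF' by (simp add: JF_flag_is_def)
    moreover have "?F' ! ?k = ?W" using d(2) by (simp add: flags_of_def)
    ultimately have "?W \<in> subspaces_of_type N U (subshape T ?k)" using sW d(4,5)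
      by (simp add: subspaces_of_type_def)
    moreover have "?F' \<in> compatible_flags_of_type N ?W alpha (tab_restrict T ?k)"
      using d(2,3) J JF_flag_is_tab_restrict[OF lenF'] by (simp add: compatible_flags_of_type_def)
    ultimately show "F \<in> ?R" using d(1) by blast
  qed
  show "?R \<subseteq> ?L"
  proof
    fix F assume "F \<in> ?R"
    then obtain W F' where W: "W \<in> subspaces_of_type N U (subshape T ?k)"
      and F': "F' \<in> compatible_flags_of_type N W alpha (tab_restrict T ?k)"
      and F: "F = F' @ [U]" by blast
    have W': "vec.subspace W" "(*v) N ` U \<subseteq> W" "W \<subseteq> U" using W
      by (auto simp: subspaces_of_type_def)
    have F'': "F' \<in> flags_of W alpha" "strictly_compatible N F'"
      "JF_flag_is N F' (tab_restrict T ?k)"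
      using F' by (auto simp: compatible_flags_of_type_def)
    have lenF': "length F' = Suc ?k" using F''(1) by (simp add: flags_of_def)
    note d = snoc_mem_flags_of[OF F''(1) W'(3) sU dU] strictly_compatible_snoc[OF F''(1,2) W'(2)]
    have "JF_flag_is N F T"
      unfolding F JF_flag_is_snoc using F''(3) JF_flag_is_tab_restrict[OF lenF'] lenF' top by simp
    then show "F \<in> ?L" using d F by (simp add: compatible_flags_of_type_def)
  qed
qed

lemma card_compatible_flags_of_type_snoc:
  fixes N :: "'k::{field,finite}^'n^'n"
  assumes sU: "vec.subspace U" and dU: "vec.dim U = sum_list (alpha @ [a])"
    and top: "subshape T (Suc (length alpha)) = JF_on U N"
  shows "card (compatible_flags_of_type N U (alpha @ [a]) T) =
    (\<Sum>W\<in>subspaces_of_type N U (subshape T (length alpha)).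
      card (compatible_flags_of_type N W alpha (tab_restrict T (length alpha))))"
proof -
  let ?k = "length alpha"
  let ?A = "\<lambda>W. (\<lambda>F'. F' @ [U]) ` compatible_flags_of_type N W alpha (tab_restrict T ?k)"
  have "card (\<Union>W\<in>subspaces_of_type N U (subshape T ?k). ?A W)
      = (\<Sum>W\<in>subspaces_of_type N U (subshape T ?k). card (?A W))"
  proof (rule card_UN_disjoint)
    show "finite (subspaces_of_type N U (subshape T ?k))" by simp
    show "\<forall>W\<in>subspaces_of_type N U (subshape T ?k). finite (?A W)"
      using finite_flags_of by (auto simp: compatible_flags_of_type_def intro: finite_subset)
    show "\<forall>W\<in>subspaces_of_type N U (subshape T ?k). \<forall>W'\<in>subspaces_of_type N U (subshape T ?k).
        W \<noteq> W' \<longrightarrow> ?A W \<inter> ?A W' = {}"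
      by (auto simp: compatible_flags_of_type_def flags_of_def)
  qed
  moreover have "card (?A W) = card (compatible_flags_of_type N W alpha (tab_restrict T ?k))" for W
    by (rule card_image) (auto simp: inj_on_def)
  ultimately show ?thesis using compatible_flags_of_type_snoc[OF assms] by simp
qed

lemma n_part_eq_sum:
  assumes sh: "bounded_partition lam m"
  shows "n_part lam = (\<Sum>j<m. lam (Suc j) choose 2)"
proof -
  have sub: "{i. lam i \<noteq> 0} \<subseteq> {1..m}"
  proof
    fix i assume "i \<in> {i. lam i \<noteq> 0}"
    then have "i \<noteq> 0" "\<not> m < i" using sh by (cases i; auto simp: bounded_partition_def)+
    then show "i \<in> {1..m}" by simp
  qed
  have "n_part lam = (\<Sum>i\<in>{1..m}. lam i choose 2)"
    unfolding n_part_def by (rule sum.mono_neutral_left) (use sub in auto)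
  also have "\<dots> = (\<Sum>j<m. lam (Suc j) choose 2)" by (simp add: sum.atLeast1_atMost_eq)
  finally show ?thesis .
qed

lemma n_comp_snoc: "n_comp (alpha @ [a]) = n_comp alpha + (a choose 2)"
  by (simp add: n_comp_def)

lemma exponent_snoc:
  assumes lam: "bounded_partition lam m" and mu: "bounded_partition mu m"
    and i1: "\<And>i. lam (Suc (Suc i)) \<le> mu (Suc i)"
      and i2: "\<And>i. mu (Suc i) \<le> lam (Suc i)"
    and a: "psum lam m = psum mu m + a"
  shows "int (\<Sum>i<m. (mu (Suc i) - lam (Suc (Suc i))) * (psum lam (Suc i) - psum mu (Suc i)))
      + (int (n_part mu) - int (n_comp alpha)) = int (n_part lam) - int (n_comp (alpha @ [a]))"
proof -
  have "lam (Suc m) = 0" using lam by (simp add: bounded_partition_def)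
  then show ?thesis
    using exponent_identity[of lam m mu, OF _ i1 i2] n_part_eq_sum[OF lam] n_part_eq_sum[OF mu] a
    by (simp add: n_comp_snoc)
qed

lemma bounded_partition_zero: "bounded_partition (\<lambda>_. 0) m"
  by (simp add: bounded_partition_def)

lemma JF_on_zero_space: "vec.dim U = 0 \<Longrightarrow> JF_on U N = (\<lambda>_. 0)"
proof -
  assume "vec.dim U = 0"
  moreover have "vec.dim (U \<inter> X) \<le> vec.dim U" for X by (rule vec.dim_subset) blast
  ultimately have dz: "vec.dim (U \<inter> X) = 0" for X by (metis le_zero_eq)
  show ?thesis by (intro ext) (simp only: JF_on_def dz, simp)
qed

lemma ssyt_zero_shape: "ssyt (\<lambda>_. 0) T \<longleftrightarrow> T = (\<lambda>_ _. 0)"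
proof
  assume "ssyt (\<lambda>_. 0) T"
  then have "T i j = 0" for i j unfolding ssyt_def in_shape_def by (metis le_0_eq not_one_le_zero)
  then show "T = (\<lambda>_ _. 0)" by blast
qed (simp add: ssyt_def in_shape_def)

lemma wt_q_zero: "0 < q \<Longrightarrow> wt_q q (\<lambda>_ _. 0) = 1"
  using wt_q_eq_prod[of "\<lambda>_. 0" "\<lambda>_ _. 0" 0 0 q]
    by (simp add: ssyt_zero_shape bounded_partition_zero)

lemma compatible_flags_zero_space:
  assumes "vec.dim U = 0" "vec.subspace U"
  shows "compatible_flags N U [] = {[U]}"
    "compatible_flags_of_type N U [] (\<lambda>_ _. 0) = {[U]}"
proof -
  have "U = {0}" using assms vec.subspace_0 by auto
  then have "compatible_flags N U [] = {[U]}"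
    by (auto simp: compatible_flags_def flags_of_def strictly_compatible_def length_Suc_conv)
  moreover have "JF_flag_is N [U] (\<lambda>_ _. 0)"
    using JF_on_zero_space[OF assms(1)] subshape_0[of "\<lambda>_. 0" "\<lambda>_ _. 0" 0]
    by (simp add: JF_flag_is_def ssyt_zero_shape bounded_partition_zero)
  ultimately show "compatible_flags N U [] = {[U]}"
    "compatible_flags_of_type N U [] (\<lambda>_ _. 0) = {[U]}"
    by (auto simp: compatible_flags_def compatible_flags_of_type_def)
qed

context
  fixes N :: "'k::{field,finite}^'n^'n" and m :: nat
  assumes nil: "((*v) N ^^ m) = (\<lambda>x. 0)"
begin

lemma card_compatible_flags_of_type:
  assumes "vec.subspace U" "(*v) N ` U \<subseteq> U" "bounded_partition (JF_on U N) m"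
    "sum_list alpha = vec.dim U" "ssyt_content (JF_on U N) alpha T"
  shows "real (card (compatible_flags_of_type N U alpha T)) =
    real CARD('k) powi (int (n_part (JF_on U N)) - int (n_comp alpha)) * wt_q (1 / real CARD('k)) T"
  using assms
proof (induction alpha arbitrary: U T rule: rev_induct)
  case Nil
  then have "vec.dim U = 0" and JF0: "JF_on U N = (\<lambda>_. 0)" using JF_on_zero_space by auto
  then have "T = (\<lambda>_ _. 0)" using Nil.prems(5)
    by (simp add: ssyt_content_def ssyt_zero_shape)
  then show ?case
    using compatible_flags_zero_space[OF \<open>vec.dim U = 0\<close> Nil.prems(1)] JF0
      wt_q_zero[of "1 / real CARD('k)"]
    by (simp add: n_part_def n_comp_def)
next
  case (snoc a alpha U T)
  note sU = snoc.prems(1) and NUU = snoc.prems(2) and sh = snoc.prems(3) and d = snoc.prems(4)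
  let ?Q = "real CARD('k)" and ?lam = "JF_on U N" and ?k = "length alpha"
  let ?mu = "subshape T ?k" and ?T' = "tab_restrict T ?k"
  have Qpos: "0 < ?Q" using two_le_card_field[where 'k='k] by simp
  have ss: "ssyt ?lam T" and hc: "has_content T (alpha @ [a])"
    using snoc.prems(5) by (auto simp: ssyt_content_def)
  have len: "length (alpha @ [a]) = Suc ?k" by simp
  have ss': "ssyt ?mu ?T'" and hc': "has_content ?T' alpha" and shm: "bounded_partition ?mu m"
    using ssyt_tab_restrict[OF ss sh hc len] has_content_tab_restrict[OF ss sh hc len]
      bounded_inner_shape[OF ss sh hc len] by simp_all
  have i1: "?lam (Suc (Suc i)) \<le> ?mu (Suc i)" and i2: "?mu i \<le> ?lam i" for i
    using shape_Suc_le_inner_shape[OF ss sh hc len] inner_shape_le[OF ss sh hc len] by blast+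
  have sums: "psum ?lam m = psum ?mu m + a"
    using psum_shape_eq_sum_list[OF ss sh hc] psum_shape_eq_sum_list[OF ss' shm hc'] by simp
  define e' where "e' = int (n_part ?mu) - int (n_comp alpha)"
  define E where
    "E = (\<Sum>i<m. (?mu (Suc i) - ?lam (Suc (Suc i))) * (psum ?lam (Suc i) - psum ?mu (Suc i)))"
  define P where
    "P = (\<Prod>i<m. qbinom (1 / ?Q) (?lam (Suc i) - ?lam (Suc (Suc i))) (?lam (Suc i) - ?mu (Suc i)))"
  have IH: "real (card (compatible_flags_of_type N W alpha ?T')) = ?Q powi e' * wt_q (1 / ?Q) ?T'"
    if "W \<in> subspaces_of_type N U ?mu" for W
  proof -
    have W: "vec.subspace W" "(*v) N ` W \<subseteq> W" "JF_on W N = ?mu"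
      using that by (auto simp: subspaces_of_type_def)
    then have "sum_list alpha = vec.dim W"
      using dim_eq_psum_JF_on[OF nil] psum_shape_eq_sum_list[OF ss' shm hc'] by simp
    then show ?thesis using snoc.IH[OF W(1,2)] W(3) shm ss' hc'
      by (simp add: ssyt_content_def e'_def)
  qed
  have "real (card (compatible_flags_of_type N U (alpha @ [a]) T)) =
      (\<Sum>W\<in>subspaces_of_type N U ?mu. real (card (compatible_flags_of_type N W alpha ?T')))"
    using card_compatible_flags_of_type_snoc[OF sU d[symmetric]]
      subshape_full[OF ss sh ssyt_entries_le_Suc[OF ss sh hc len]]
    by (simp add: fun_eq_iff)
  also have "\<dots> = real (card (subspaces_of_type N U ?mu)) * (?Q powi e' * wt_q (1 / ?Q) ?T')"
    using IH by simp
  also have "real (card (subspaces_of_type N U ?mu)) = ?Q ^ E * P"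
    unfolding E_def P_def using shm i1 i2
    by (intro card_subspaces_of_type[OF sU NUU nil]) (auto simp: bounded_partition_def)
  also have "?Q ^ E * P * (?Q powi e' * wt_q (1 / ?Q) ?T')
      = ?Q powi (int E + e') * (wt_q (1 / ?Q) ?T' * P)"
    using Qpos by (simp add: power_int_add mult_ac)
  also have "wt_q (1 / ?Q) ?T' * P = wt_q (1 / ?Q) T"
    using wt_q_tab_restrict[OF ss sh hc len] Qpos unfolding P_def
      by (simp add: prod.atLeast1_atMost_eq)
  finally show ?case using exponent_snoc[OF sh shm i1 i2 sums, of alpha] by (simp add: E_def e'_def)
qed

lemma compatible_flag_has_tableau:
  assumes "vec.subspace U" "(*v) N ` U \<subseteq> U" "bounded_partition (JF_on U N) m"
    "sum_list alpha = vec.dim U" "F \<in> compatible_flags N U alpha"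
  shows "\<exists>T. ssyt_content (JF_on U N) alpha T \<and> JF_flag_is N F T"
  using assms
proof (induction alpha arbitrary: U F rule: rev_induct)
  case Nil
  then have "vec.dim U = 0" "JF_on U N = (\<lambda>_. 0)" using JF_on_zero_space by auto
  moreover have "F = [U]"
    using Nil.prems(5) compatible_flags_zero_space[OF \<open>vec.dim U = 0\<close> Nil.prems(1)]
    by simp
  moreover have "JF_flag_is N [U] (\<lambda>_ _. 0)"
    using compatible_flags_zero_space[OF \<open>vec.dim U = 0\<close> Nil.prems(1)]
    by (auto simp: compatible_flags_of_type_def)
  ultimately show ?case
    by (intro exI[of _ "\<lambda>_ _. 0"]) (simp add: ssyt_content_def ssyt_zero_shape has_content_def)
next
  case (snoc a alpha U F)
  note sU = snoc.prems(1) and NUU = snoc.prems(2) and sh = snoc.prems(3) and d = snoc.prems(4)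
  let ?lam = "JF_on U N" and ?k = "length alpha" and ?W = "F ! length alpha"
  let ?mu = "JF_on ?W N"
  have F: "F \<in> flags_of U (alpha @ [a])" "strictly_compatible N F"
    using snoc.prems(5) by (auto simp: compatible_flags_def)
  note dc = flag_butlast[OF F]
  have sW: "vec.subspace ?W" and dW: "vec.dim ?W = sum_list alpha"
    using dc(2) unfolding flags_of_def
      by (metis (mono_tags, lifting) mem_Collect_eq order_refl take_all)+
  have i1: "?mu (Suc i) \<le> ?lam (Suc i)" and i2: "?lam (Suc (Suc i)) \<le> ?mu (Suc i)" for i
    using JF_on_interlace[OF sU NUU sW dc(4,5)] by blast+
  have "?mu (Suc (Suc i)) \<le> ?mu (Suc i)" for i using i1[of "Suc i"] i2[of i] by (rule le_trans)
  then have shm: "bounded_partition ?mu m"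
    using JF_on_vanish[OF nil] by (simp add: bounded_partition_def)
  have NW: "(*v) N ` ?W \<subseteq> ?W" using dc(4,5) by blast
  have "butlast F \<in> compatible_flags N ?W alpha" using dc(2,3)
    by (simp add: compatible_flags_def)
  then obtain T' where T': "ssyt_content ?mu alpha T'" "JF_flag_is N (butlast F) T'"
    using snoc.IH[OF sW NW shm dW[symmetric]] by blast
  have ss': "ssyt ?mu T'" and hc': "has_content T' alpha" using T'(1)
    by (auto simp: ssyt_content_def)
  have "a = (\<Sum>i\<in>{1..m}. ?lam i - ?mu i)"
  proof -
    have "?mu i \<le> ?lam i" for i using i1 by (cases i) auto
    then have "(\<Sum>i\<in>{1..m}. ?lam i - ?mu i) = psum ?lam m - psum ?mu m"
      unfolding psum_def by (simp add: sum_subtractf_nat)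
    then show ?thesis using dim_eq_psum_JF_on[OF nil, of U] dim_eq_psum_JF_on[OF nil, of ?W] d dW
      by simp
  qed
  note ext = ssyt_tab_extend[OF ss' shm hc' refl sh i1 i2]
    has_content_tab_extend[OF ss' shm hc' refl sh i1 i2 this]
    tab_restrict_tab_extend[OF ss' shm hc' refl sh i1 i2]
    subshape_tab_extend_top[OF ss' shm hc' refl sh i1 i2]
  have "length (butlast F) = Suc ?k" using dc(2) by (simp add: flags_of_def)
  then have "JF_flag_is N F (tab_extend T' ?mu ?lam ?k)"
    using JF_flag_is_tab_restrict[of "butlast F" ?k N] JF_flag_is_snoc[of N "butlast F" U]
      dc(1) T'(2) ext(3,4)
    by metis
  then show ?case using ext(1,2) by (auto simp: ssyt_content_def)
qed

end

lemma compatible_flags_of_type_tableau_unique: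
  assumes sh: "bounded_partition lam m" and T1: "ssyt_content lam alpha T1"
    and T2: "ssyt_content lam alpha T2"
    and F: "F \<in> compatible_flags_of_type N U alpha T1"
      "F \<in> compatible_flags_of_type N U alpha T2"
  shows "T1 = T2"
proof (rule ssyt_eq_if_subshapes_eq)
  have len: "length F = Suc (length alpha)" using F(1)
    by (simp add: compatible_flags_of_type_def flags_of_def)
  show "subshape T1 j = subshape T2 j" if "j \<le> length alpha" for j
    using F len that by (auto simp: compatible_flags_of_type_def JF_flag_is_def)
qed (use T1 T2 sh ssyt_entries_le_length in \<open>auto simp: ssyt_content_def\<close>)

lemma card_compatible_flags_eq_sum:
  fixes N :: "'k::{field,finite}^'n^'n"
  assumes nil: "((*v) N ^^ m) = (\<lambda>x. 0)" and sh: "bounded_partition (JF_on UNIV N) m"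
    and d: "sum_list alpha = vec.dim (UNIV :: ('k^'n) set)"
  shows "card (compatible_flags N UNIV alpha) =
    (\<Sum>T\<in>{T. ssyt_content (JF_on UNIV N) alpha T}. card (compatible_flags_of_type N UNIV alpha T))"
proof -
  let ?S = "{T. ssyt_content (JF_on UNIV N) alpha T}"
  have "compatible_flags N UNIV alpha = (\<Union>T\<in>?S. compatible_flags_of_type N UNIV alpha T)"
    using compatible_flag_has_tableau[OF nil vec.subspace_UNIV _ sh d]
    by (fastforce simp: compatible_flags_def compatible_flags_of_type_def)
  moreover have "card (\<Union>T\<in>?S. compatible_flags_of_type N UNIV alpha T) =
      (\<Sum>T\<in>?S. card (compatible_flags_of_type N UNIV alpha T))"
  proof (rule card_UN_disjoint)
    show "finite ?S" by (rule finite_ssyt[OF sh])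
    show "\<forall>T\<in>?S. finite (compatible_flags_of_type N UNIV alpha T)"
      using finite_flags_of[of "UNIV :: ('k^'n) set" alpha]
        by (auto simp: compatible_flags_of_type_def)
    show "\<forall>T1\<in>?S. \<forall>T2\<in>?S. T1 \<noteq> T2 \<longrightarrow>
        compatible_flags_of_type N UNIV alpha T1 \<inter> compatible_flags_of_type N UNIV alpha T2 = {}"
      using compatible_flags_of_type_tableau_unique[OF sh] by blast
  qed
  ultimately show ?thesis by simp
qed

theorem theorem5p8:
  fixes N :: "'k::{field,finite}^'n^'n"
    and lam :: "nat \<Rightarrow> nat"
    and alpha :: "nat list"
  defines "q \<equiv> 1 / real CARD('k)"
  assumes "is_partition_of lam CARD('n)"
    and "nilpotent_mat N"
    and "JF N = lam"
    and "sum_list alpha = CARD('n)"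
  shows "(\<forall>T. ssyt_content lam alpha T \<longrightarrow>
           wt_q q T = q powi (int (n_part lam) - int (n_comp alpha)) *
             real (card {F \<in> Fl alpha. strictly_compatible N F \<and> JF_flag_is N F T})) \<and>
         (\<Sum>T\<in>{T. ssyt_content lam alpha T}. wt_q q T) =
           q powi (int (n_part lam) - int (n_comp alpha)) *
             real (card {F \<in> Fl alpha. strictly_compatible N F})"
proof -
  obtain m where nil: "((*v) N ^^ m) = (\<lambda>x. 0)" using assms(3)
    by (auto simp: nilpotent_mat_def)
  have lam: "JF_on UNIV N = lam" using assms(4) by (simp add: JF_def)
  have sh: "bounded_partition lam m"
    using assms(2) JF_on_vanish[OF nil, of _ UNIV] lam
      by (auto simp: is_partition_of_def bounded_partition_def)
  have d: "sum_list alpha = vec.dim (UNIV :: ('k^'n) set)" using assms(5)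
    by (simp add: card_cart_basis)
  let ?e = "int (n_part lam) - int (n_comp alpha)"
  have "q powi ?e * real CARD('k) powi ?e = 1" unfolding q_def
    by (simp add: power_int_mult_distrib[symmetric])
  then have wt: "wt_q q T = q powi ?e * real (card (compatible_flags_of_type N UNIV alpha T))"
    if "ssyt_content lam alpha T" for T
    using card_compatible_flags_of_type[OF nil vec.subspace_UNIV _ _ d] that sh lam
    unfolding q_def by (simp add: mult.assoc[symmetric])
  have "{F \<in> Fl alpha. strictly_compatible N F \<and> JF_flag_is N F T}
      = compatible_flags_of_type N UNIV alpha T"
    "{F \<in> Fl alpha. strictly_compatible N F} = compatible_flags N UNIV alpha" for T
    by (simp_all add: compatible_flags_of_type_def compatible_flags_def Fl_eq_flags_of)
  then show ?thesis
    using wt card_compatible_flags_eq_sum[OF nil _ d] sh lam by (simp add: sum_distrib_left)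
qed

end
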